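(* Let $(X,\mathcal U)$ be a non-discrete uniform space. If $(X,\mathcal U)$ is $\mathrm{add}(\mathcal U)$-precompact, then $$\mathcal N_e(F(X,\mathcal U))=_T\mathcal U^\omega .$$
   Context: Uniform spaces are separated. A uniformity $\mathcal U$ on $X$ is given by entourages: a family of symmetric subsets of $X\times X$ containing the diagonal $\Delta$, closed under symmetric supersets and finite intersections, such that every $V\in\mathcal U$ has $U\in\mathcal U$ with $2U=U+U\subseteq V$ (composition of relations), and $\bigcap\mathcal U=\Delta$. $(X,\mathcal U)$ is discrete if $\Delta\in\mathcal U$. For $U\in\mathcal U$, $B(x,U)=\{y\in X:(x,y)\in U\}$. For an infinite cardinal $\tau$, $(X,\mathcal U)$ is $\tau$-precompact if for every $U\in\mathcal U$ there is $A\subseteq X$ with $|A|<\tau$ and $X=\bigcup_{a\in A}B(a,U)$. $\mathcal U$ is a directed poset under reverse inclusion, and $\mathcal U^\omega$ carries the coordinatewise order. For a directed poset $P$, a subset is bounded if it has a single upper bound in $P$; $\mathrm{add}(P)$ is the least cardinality of an unbounded subset of $P$, with $\mathrm{add}(P)=1$ if $P$ has a largest element. (For non-discrete $(X,\mathcal U)$, $\mathrm{add}(\mathcal U)$ is an infinite cardinal.) $F(X,\mathcal U)$ is the free topological group over $(X,\mathcal U)$: the free group on $X$ with the finest group topology making the inclusion $X\to F(X,\mathcal U)$ uniformly continuous with respect to the two-sided uniformity; it is characterized by: the inclusion is uniformly continuous and every uniformly continuous map from $(X,\mathcal U)$ into a topological group (with its two-sided uniformity) extends uniquely to a continuous homomorphism.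 All topological groups are Hausdorff. $\mathcal N_e(G)$ is the filter of neighbourhoods of the identity of $G$, ordered by reverse inclusion. For directed posets $P,Q$, $P\le_T Q$ (Tukey order) means there is a map $Q\to P$ sending cofinal subsets to cofinal subsets (equivalently, a map $P\to Q$ sending unbounded subsets to unbounded subsets); $P=_TQ$ means $P\le_TQ$ and $Q\le_TP$. *)

theory Defs
  imports "HOL-Analysis.Analysis" "HOL-Algebra.Group"
begin

unbundle cardinal_syntax

section \<open>Uniform spaces given by symmetric entourages\<close>

text \<open>
  All uniform spaces are separated. The condition \<open>X \<times> X \<in> \<U>\<close> is closure under the empty
  intersection.
\<close>

definition uniform_space_on :: "'a set \<Rightarrow> ('a \<times> 'a) set set \<Rightarrow> bool" where
  "uniform_space_on X \<U> \<longleftrightarrow>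
     (\<forall>V\<in>\<U>. V \<subseteq> X \<times> X \<and> sym V \<and> Id_on X \<subseteq> V) \<and>
     (\<forall>V\<in>\<U>. \<forall>W. V \<subseteq> W \<and> W \<subseteq> X \<times> X \<and> sym W \<longrightarrow> W \<in> \<U>) \<and>
     X \<times> X \<in> \<U> \<and>
     (\<forall>V\<in>\<U>. \<forall>W\<in>\<U>. V \<inter> W \<in> \<U>) \<and>
     (\<forall>V\<in>\<U>. \<exists>U\<in>\<U>. U O U \<subseteq> V) \<and>
     \<Inter>\<U> = Id_on X"

lemma uniform_space_on_Int:
  assumes "uniform_space_on X \<U>" "V \<in> \<U>" "W \<in> \<U>"
  shows "V \<inter> W \<in> \<U>"
proof -
  have "\<forall>V\<in>\<U>. \<forall>W\<in>\<U>. V \<inter> W \<in> \<U>"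
    using assms(1) unfolding uniform_space_on_def by (elim conjE)
  then show ?thesis
    using assms(2,3) by simp
qed

lemma uniform_space_on_subset:
  assumes "uniform_space_on X \<U>" "V \<in> \<U>"
  shows "V \<subseteq> X \<times> X"
proof -
  have "\<forall>V\<in>\<U>. V \<subseteq> X \<times> X \<and> sym V \<and> Id_on X \<subseteq> V"
    using assms(1) unfolding uniform_space_on_def by (elim conjE)
  then show ?thesis
    using assms(2) by simp
qed

definition discrete_uniformity :: "'a set \<Rightarrow> ('a \<times> 'a) set set \<Rightarrow> bool" where
  "discrete_uniformity X \<U> \<longleftrightarrow> Id_on X \<in> \<U>"

definition entourage_ball :: "'a set \<Rightarrow> 'a \<Rightarrow> ('a \<times> 'a) set \<Rightarrow> 'a set" where
  "entourage_ball X x U = {y \<in> X. (x, y) \<in> U}"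

text \<open>Cardinal numbers are represented, as in the library, by relations up to \<open>=o\<close>.\<close>

definition precompact_below :: "'c rel \<Rightarrow> 'a set \<Rightarrow> ('a \<times> 'a) set set \<Rightarrow> bool" where
  "precompact_below \<tau> X \<U> \<longleftrightarrow>
     (\<forall>U\<in>\<U>. \<exists>A\<subseteq>X. |A| <o \<tau> \<and> X = (\<Union>a\<in>A. entourage_ball X a U))"

definition uniformly_continuous_between ::
  "('a \<times> 'a) set set \<Rightarrow> ('b \<times> 'b) set set \<Rightarrow> ('a \<Rightarrow> 'b) \<Rightarrow> bool" where
  "uniformly_continuous_between \<U> \<V> f \<longleftrightarrow>
     (\<forall>V\<in>\<V>. \<exists>U\<in>\<U>. \<forall>(x, y)\<in>U. (f x, f y) \<in> V)"


section \<open>Directed posets and the Tukey order\<close>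

text \<open>
  A poset is represented by its reflexive order relation \<open>P\<close>, where \<open>(p, q) \<in> P\<close> means \<open>p \<le> q\<close>;
  its underlying set is \<open>Field P\<close>.
\<close>

definition reverse_inclusion :: "'a set set \<Rightarrow> 'a set rel" where
  "reverse_inclusion \<A> = {(V, W). V \<in> \<A> \<and> W \<in> \<A> \<and> W \<subseteq> V}"

definition omega_power :: "'p rel \<Rightarrow> (nat \<Rightarrow> 'p) rel" where
  "omega_power P = {(s, t). \<forall>n. (s n, t n) \<in> P}"

definition cofinal_subset :: "'p rel \<Rightarrow> 'p set \<Rightarrow> bool" where
  "cofinal_subset P C \<longleftrightarrow> C \<subseteq> Field P \<and> (\<forall>p\<in>Field P. \<exists>c\<in>C. (p, c) \<in> P)"

definition unbounded_subset :: "'p rel \<Rightarrow> 'p set \<Rightarrow> bool" where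
  "unbounded_subset P S \<longleftrightarrow> S \<subseteq> Field P \<and> \<not> (\<exists>u\<in>Field P. \<forall>s\<in>S. (s, u) \<in> P)"

definition has_largest :: "'p rel \<Rightarrow> bool" where
  "has_largest P \<longleftrightarrow> (\<exists>m\<in>Field P. \<forall>p\<in>Field P. (p, m) \<in> P)"

text \<open>
  If \<open>P\<close> is a directed poset without largest element, then \<open>Field P\<close> itself is unbounded, so an
  unbounded subset of least cardinality exists. The value is only determined up to \<open>=o\<close>; the singleton represents the cardinal 1.
\<close>

definition add_card :: "'p rel \<Rightarrow> 'p rel" where
  "add_card P =
     (if has_largest P then |{undefined}|
      else |SOME S. unbounded_subset P S \<and> (\<forall>S'. unbounded_subset P S' \<longrightarrow> |S| \<le>o |S'| )| )"

definition tukey_le :: "'p rel \<Rightarrow> 'q rel \<Rightarrow> bool" (infix "\<le>\<^sub>T" 50) where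
  "P \<le>\<^sub>T Q \<longleftrightarrow>
     (\<exists>f. f ` Field Q \<subseteq> Field P \<and>
          (\<forall>C. cofinal_subset Q C \<longrightarrow> cofinal_subset P (f ` C)))"

definition tukey_eq :: "'p rel \<Rightarrow> 'q rel \<Rightarrow> bool" (infix "=\<^sub>T" 50) where
  "P =\<^sub>T Q \<longleftrightarrow> P \<le>\<^sub>T Q \<and> Q \<le>\<^sub>T P"


section \<open>Topological groups\<close>

text \<open>
  All topological groups are Hausdorff. The two-sided uniformity is the join of the left and the
  right one, again presented by symmetric entourages.
\<close>

definition topological_group_on :: "('g, 'm) monoid_scheme \<Rightarrow> 'g topology \<Rightarrow> bool" where
  "topological_group_on G T \<longleftrightarrow>
     group G \<and> topspace T = carrier G \<and>
     continuous_map (prod_topology T T) T (\<lambda>(x, y). x \<otimes>\<^bsub>G\<^esub> y) \<and>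
     continuous_map T T (\<lambda>x. inv\<^bsub>G\<^esub> x) \<and>
     Hausdorff_space T"

definition identity_neighbourhoods :: "('g, 'm) monoid_scheme \<Rightarrow> 'g topology \<Rightarrow> 'g set set" where
  "identity_neighbourhoods G T =
     {V. V \<subseteq> carrier G \<and> (\<exists>W. openin T W \<and> \<one>\<^bsub>G\<^esub> \<in> W \<and> W \<subseteq> V)}"

definition two_sided_uniformity :: "('g, 'm) monoid_scheme \<Rightarrow> 'g topology \<Rightarrow> ('g \<times> 'g) set set" where
  "two_sided_uniformity G T =
     {E. E \<subseteq> carrier G \<times> carrier G \<and> sym E \<and>
         (\<exists>V\<in>identity_neighbourhoods G T.
            {(g, h) \<in> carrier G \<times> carrier G.
               inv\<^bsub>G\<^esub> g \<otimes>\<^bsub>G\<^esub> h \<in> V \<and> g \<otimes>\<^bsub>G\<^esub> inv\<^bsub>G\<^esub> h \<in> V} \<subseteq> E)}"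


section \<open>Free groups\<close>

text \<open>
  The letter \<open>(x, True)\<close> stands for the generator \<open>x\<close> and \<open>(x, False)\<close> for its inverse; group
  elements are reduced words.
\<close>

definition inverse_letter :: "'a \<times> bool \<Rightarrow> 'a \<times> bool" where
  "inverse_letter l = (fst l, \<not> snd l)"

definition reduced_word :: "('a \<times> bool) list \<Rightarrow> bool" where
  "reduced_word w \<longleftrightarrow> successively (\<lambda>l m. m \<noteq> inverse_letter l) w"

fun letter_mult :: "'a \<times> bool \<Rightarrow> ('a \<times> bool) list \<Rightarrow> ('a \<times> bool) list" where
  "letter_mult l [] = [l]"
| "letter_mult l (m # w) = (if m = inverse_letter l then w else l # m # w)"

definition free_group :: "'a set \<Rightarrow> ('a \<times> bool) list monoid" where
  "free_group X =
     \<lparr>carrier = {w \<in> lists (X \<times> UNIV). reduced_word w},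
      mult = (\<lambda>u v. foldr letter_mult u v),
      one = []\<rparr>"

definition free_generator :: "'a \<Rightarrow> ('a \<times> bool) list" where
  "free_generator x = [(x, True)]"

lemma inverse_letter_inverse_letter [simp]: "inverse_letter (inverse_letter l) = l"
  by (simp add: inverse_letter_def)

lemma reduced_letter_mult: "reduced_word w \<Longrightarrow> reduced_word (letter_mult l w)"
  by (cases "(l, w)" rule: letter_mult.cases) (auto simp: reduced_word_def successively_Cons)

lemma reduced_foldr: "reduced_word v \<Longrightarrow> reduced_word (foldr letter_mult u v)"
  by (induction u) (auto intro: reduced_letter_mult)

lemma letter_mult_inverse:
  "reduced_word w \<Longrightarrow> letter_mult l (letter_mult (inverse_letter l) w) = w"
  by (cases w; cases "tl w") (auto simp: reduced_word_def)

lemma foldr_letter_mult: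
  "reduced_word v \<Longrightarrow>
     foldr letter_mult (letter_mult l u) v = letter_mult l (foldr letter_mult u v)"
  by (cases u) (auto simp: letter_mult_inverse reduced_foldr)

lemma foldr_letter_mult_assoc:
  "reduced_word w \<Longrightarrow>
     foldr letter_mult (foldr letter_mult u v) w = foldr letter_mult u (foldr letter_mult v w)"
  by (induction u) (auto simp: foldr_letter_mult)

lemma foldr_letter_mult_Nil: "reduced_word u \<Longrightarrow> foldr letter_mult u [] = u"
proof (induction u)
  case (Cons l u)
  then show ?case
    by (cases u) (auto simp: reduced_word_def)
qed simp

lemma letter_mult_lists:
  "\<lbrakk>l \<in> A; w \<in> lists A\<rbrakk> \<Longrightarrow> letter_mult l w \<in> lists A"
  by (cases w) auto

lemma foldr_letter_mult_lists:
  "\<lbrakk>u \<in> lists A; v \<in> lists A\<rbrakk> \<Longrightarrow> foldr letter_mult u v \<in> lists A"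
  by (induction u) (auto simp: letter_mult_lists simp del: in_lists_conv_set)

lemma foldr_inverse_word:
  "reduced_word v \<Longrightarrow>
     foldr letter_mult (map inverse_letter (rev u)) (foldr letter_mult u v) = v"
proof (induction u arbitrary: v)
  case (Cons l u)
  have "letter_mult (inverse_letter l) (letter_mult l (foldr letter_mult u v)) = foldr letter_mult u v"
    using letter_mult_inverse[of "foldr letter_mult u v" "inverse_letter l"] Cons.prems
    by (simp add: reduced_foldr)
  then show ?case
    using Cons by simp
qed simp

lemma group_free_group: "group (free_group X)"
proof (rule groupI)
  fix u assume u: "u \<in> carrier (free_group X)"
  let ?v = "foldr letter_mult (map inverse_letter (rev u)) []"
  have "map inverse_letter (rev u) \<in> lists (X \<times> UNIV)"
    using u by (fastforce simp: free_group_def inverse_letter_def)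
  then have "?v \<in> carrier (free_group X)"
    using foldr_letter_mult_lists[of _ "X \<times> UNIV" "[]"] reduced_foldr[of "[]"]
    by (auto simp: free_group_def reduced_word_def simp del: in_lists_conv_set)
  moreover have "foldr letter_mult ?v u = []"
  proof -
    have "reduced_word u"
      using u by (simp add: free_group_def)
    then have "foldr letter_mult ?v u = foldr letter_mult (map inverse_letter (rev u)) (foldr letter_mult u [])"
      by (simp only: foldr_letter_mult_assoc foldr_letter_mult_Nil foldr.simps id_apply)
    then show ?thesis
      using foldr_inverse_word[of "[]" u] by (simp add: reduced_word_def)
  qed
  ultimately show "\<exists>v\<in>carrier (free_group X). v \<otimes>\<^bsub>free_group X\<^esub> u = \<one>\<^bsub>free_group X\<^esub>"
    by (auto simp: free_group_def)
qed (auto simp: free_group_def foldr_letter_mult_assoc reduced_foldr reduced_word_def[of "[]"]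
      foldr_letter_mult_lists simp del: in_lists_conv_set)


section \<open>The free topological group over a uniform space\<close>

definition free_group_topology_candidate ::
  "'a set \<Rightarrow> ('a \<times> 'a) set set \<Rightarrow> ('a \<times> bool) list topology \<Rightarrow> bool" where
  "free_group_topology_candidate X \<U> T \<longleftrightarrow>
     topological_group_on (free_group X) T \<and>
     uniformly_continuous_between \<U> (two_sided_uniformity (free_group X) T) free_generator"

text \<open>
  The finest candidate, written as the supremum of all candidates: it is finer than every candidate
  (\<open>openin_free_group_topology\<close>), and it is itself a candidate as soon as one exists
  (\<open>free_group_topology_candidate\<close>), which is the case for every separated uniform space.
\<close>

definition free_group_topology ::
  "'a set \<Rightarrow> ('a \<times> 'a) set set \<Rightarrow> ('a \<times> bool) list topology" where
  "free_group_topology X \<U> =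
     topology_generated_by {S. \<exists>T. free_group_topology_candidate X \<U> T \<and> openin T S}"

lemma free_generator_carrier: "x \<in> X \<Longrightarrow> free_generator x \<in> carrier (free_group X)"
  by (simp add: free_generator_def free_group_def reduced_word_def)

lemma openin_free_group_topology:
  assumes "free_group_topology_candidate X \<U> T" "openin T S"
  shows "openin (free_group_topology X \<U>) S"
  unfolding free_group_topology_def using assms by (auto intro!: topology_generated_by_Basis)

lemma topspace_free_group_topology:
  assumes "free_group_topology_candidate X \<U> T"
  shows "topspace (free_group_topology X \<U>) = carrier (free_group X)"
proof -
  have "topspace T' = carrier (free_group X)" if "free_group_topology_candidate X \<U> T'" for T'
    using that by (simp add: free_group_topology_candidate_def topological_group_on_def)
  then show ?thesis
    unfolding free_group_topology_def topology_generated_by_topspace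
    using assms openin_subset openin_topspace by blast
qed

lemma continuous_map_into_free_group_topology:
  assumes "free_group_topology_candidate X \<U> T"
    and f: "\<And>T'. free_group_topology_candidate X \<U> T' \<Longrightarrow> continuous_map Z T' f"
  shows "continuous_map Z (free_group_topology X \<U>) f"
  unfolding free_group_topology_def continuous_on_generated_topo_iff
proof (intro conjI allI impI)
  let ?S = "{S. \<exists>T. free_group_topology_candidate X \<U> T \<and> openin T S}"
  show "f ` topspace Z \<subseteq> \<Union> ?S"
    using f[OF assms(1)] assms(1) openin_topspace[of T] unfolding continuous_map_def by blast
  fix S assume "S \<in> ?S"
  then obtain T' where T': "free_group_topology_candidate X \<U> T'" "openin T' S"
    by blast
  show "openin Z (f -` S \<inter> topspace Z)"
    using openin_continuous_map_preimage[OF f[OF T'(1)] T'(2)]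
    by (simp add: vimage_def Int_def conj_commute)
qed

lemma candidate_entourage:
  assumes "free_group_topology_candidate X \<U> T"
    and W: "openin T W" "\<one>\<^bsub>free_group X\<^esub> \<in> W"
  defines "G \<equiv> free_group X"
  shows "\<exists>U\<in>\<U>. \<forall>x y. (x, y) \<in> U \<longrightarrow> inv\<^bsub>G\<^esub> free_generator x \<otimes>\<^bsub>G\<^esub> free_generator y \<in> W \<and>
            free_generator x \<otimes>\<^bsub>G\<^esub> inv\<^bsub>G\<^esub> free_generator y \<in> W"
proof -
  interpret group G
    unfolding G_def by (rule group_free_group)
  have T: "topspace T = carrier G" "continuous_map T T (\<lambda>x. inv\<^bsub>G\<^esub> x)"
    using assms(1) by (simp_all add: free_group_topology_candidate_def topological_group_on_def G_def)
  define V where "V = W \<inter> {x \<in> carrier G. inv\<^bsub>G\<^esub> x \<in> W}"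
  have V_open: "openin T V"
    using openin_continuous_map_preimage[OF T(2) W(1)] W(1) T(1) by (auto simp: V_def)
  have V_one: "\<one>\<^bsub>G\<^esub> \<in> V"
    using W(2) by (simp add: V_def G_def[symmetric])
  have V_inv: "inv\<^bsub>G\<^esub> v \<in> V" if "v \<in> V" for v
    using that openin_subset[OF V_open] T(1) by (auto simp: V_def)
  let ?E = "{(g, h) \<in> carrier G \<times> carrier G. inv\<^bsub>G\<^esub> g \<otimes>\<^bsub>G\<^esub> h \<in> V \<and> g \<otimes>\<^bsub>G\<^esub> inv\<^bsub>G\<^esub> h \<in> V}"
  have "sym ?E"
  proof (rule symI)
    fix g h assume "(g, h) \<in> ?E"
    then show "(h, g) \<in> ?E"
      using V_inv[of "inv\<^bsub>G\<^esub> g \<otimes>\<^bsub>G\<^esub> h"] V_inv[of "g \<otimes>\<^bsub>G\<^esub> inv\<^bsub>G\<^esub> h"] by (auto simp: inv_mult_group)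
  qed
  moreover have "V \<in> identity_neighbourhoods G T"
    using V_open V_one openin_subset[OF V_open] T(1) by (auto simp: identity_neighbourhoods_def)
  ultimately have "?E \<in> two_sided_uniformity G T"
    unfolding two_sided_uniformity_def by blast
  then obtain U where "U \<in> \<U>" "\<forall>(x, y)\<in>U. (free_generator x, free_generator y) \<in> ?E"
    using assms(1)
    unfolding free_group_topology_candidate_def uniformly_continuous_between_def G_def by blast
  then show ?thesis
    by (intro bexI[of _ U]) (auto simp: V_def)
qed

lemma free_group_topology_candidate:
  assumes unif: "uniform_space_on X \<U>" and T: "free_group_topology_candidate X \<U> T"
  shows "free_group_topology_candidate X \<U> (free_group_topology X \<U>)"
proof -
  let ?T = "free_group_topology X \<U>" and ?S = "{S. \<exists>T. free_group_topology_candidate X \<U> T \<and> openin T S}"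
  define G where "G = free_group X"
  interpret group G
    unfolding G_def by (rule group_free_group)
  have top: "topspace ?T = carrier G"
    using topspace_free_group_topology[OF T] by (simp add: G_def)
  have cand: "topspace T' = carrier G" "continuous_map ?T T' id"
    "continuous_map (prod_topology T' T') T' (\<lambda>(x, y). x \<otimes>\<^bsub>G\<^esub> y)"
    "continuous_map T' T' (\<lambda>x. inv\<^bsub>G\<^esub> x)" "Hausdorff_space T'"
    if "free_group_topology_candidate X \<U> T'" for T'
  proof -
    show *: "topspace T' = carrier G" "continuous_map (prod_topology T' T') T' (\<lambda>(x, y). x \<otimes>\<^bsub>G\<^esub> y)"
      "continuous_map T' T' (\<lambda>x. inv\<^bsub>G\<^esub> x)" "Hausdorff_space T'"
      using that by (simp_all add: free_group_topology_candidate_def topological_group_on_def G_def)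
    show "continuous_map ?T T' id"
      using openin_free_group_topology[OF that] top *(1)
      by (intro topology_finer_continuous_id[THEN iffD1]) auto
  qed
  have "continuous_map (prod_topology ?T ?T) ?T (\<lambda>(x, y). x \<otimes>\<^bsub>G\<^esub> y)"
  proof (rule continuous_map_into_free_group_topology[OF T])
    fix T' assume T': "free_group_topology_candidate X \<U> T'"
    have "continuous_map (prod_topology ?T ?T) (prod_topology T' T') (\<lambda>(x, y). (id x, id y))"
      using cand(2)[OF T'] by (intro continuous_map_prod_top[THEN iffD2] disjI2 conjI)
    from continuous_map_compose[OF this cand(3)[OF T']]
    show "continuous_map (prod_topology ?T ?T) T' (\<lambda>(x, y). x \<otimes>\<^bsub>G\<^esub> y)"
      by (simp add: o_def case_prod_unfold)
  qed
  moreover have "continuous_map ?T ?T (\<lambda>x. inv\<^bsub>G\<^esub> x)"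
  proof (rule continuous_map_into_free_group_topology[OF T])
    fix T' assume T': "free_group_topology_candidate X \<U> T'"
    show "continuous_map ?T T' (\<lambda>x. inv\<^bsub>G\<^esub> x)"
      using continuous_map_compose[OF cand(2)[OF T'] cand(4)[OF T']] by (simp add: o_def)
  qed
  moreover have "Hausdorff_space ?T"
    unfolding Hausdorff_space_def
  proof (intro allI impI)
    fix x y assume "x \<in> topspace ?T \<and> y \<in> topspace ?T \<and> x \<noteq> y"
    then have "x \<in> topspace T \<and> y \<in> topspace T \<and> x \<noteq> y"
      by (simp add: top cand(1)[OF T])
    then obtain A B where "openin T A" "openin T B" "x \<in> A" "y \<in> B" "disjnt A B"
      using cand(5)[OF T, unfolded Hausdorff_space_def, rule_format] by blast
    then show "\<exists>A B. openin ?T A \<and> openin ?T B \<and> x \<in> A \<and> y \<in> B \<and> disjnt A B"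
      by (intro exI[of _ A] exI[of _ B]) (simp add: openin_free_group_topology[OF T])
  qed
  ultimately have "topological_group_on G ?T"
    using top is_group by (simp add: topological_group_on_def)
  moreover have "uniformly_continuous_between \<U> (two_sided_uniformity G ?T) free_generator"
    unfolding uniformly_continuous_between_def
  proof
    let ?P = "\<lambda>U W. \<forall>x y. (x, y) \<in> U \<longrightarrow> inv\<^bsub>G\<^esub> free_generator x \<otimes>\<^bsub>G\<^esub> free_generator y \<in> W \<and>
            free_generator x \<otimes>\<^bsub>G\<^esub> inv\<^bsub>G\<^esub> free_generator y \<in> W"
    have ent: "\<exists>U\<in>\<U>. ?P U W" if "generate_topology_on ?S W" "\<one>\<^bsub>G\<^esub> \<in> W" for W
      using that
    proof (induction rule: generate_topology_on.induct)
      case (Int A B)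
      have one: "\<one>\<^bsub>G\<^esub> \<in> A" "\<one>\<^bsub>G\<^esub> \<in> B"
        by (rule IntD1[OF Int.prems], rule IntD2[OF Int.prems])
      from Int.IH(1)[OF one(1)] obtain U where U: "U \<in> \<U>" "?P U A"
        by (rule bexE)
      from Int.IH(2)[OF one(2)] obtain V where V: "V \<in> \<U>" "?P V B"
        by (rule bexE)
      have "U \<inter> V \<in> \<U>"
        using uniform_space_on_Int[OF unif U(1) V(1)] .
      then show ?case
        by (rule bexI[rotated]) (use U(2) V(2) in simp)
    next
      case (UN K)
      from UN.prems obtain k where k: "k \<in> K" "\<one>\<^bsub>G\<^esub> \<in> k"
        by (rule UnionE)
      from UN.IH[OF k] obtain U where U: "U \<in> \<U>" "?P U k"
        by (rule bexE)
      have "?P U (\<Union> K)"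
        using U(2) k(1) by (meson UnionI)
      then show ?case
        using U(1) by (rule bexI)
    next
      case (Basis W)
      from Basis.hyps obtain T' where "free_group_topology_candidate X \<U> T'" "openin T' W"
        by (elim CollectE exE conjE)
      then show ?case
        using candidate_entourage[of X \<U> T' W, folded G_def] Basis.prems by simp
    next
      case Empty
      then show ?case
        by (rule emptyE)
    qed
    fix E assume "E \<in> two_sided_uniformity G ?T"
    then obtain V where V: "V \<in> identity_neighbourhoods G ?T"
      and E: "{(g, h) \<in> carrier G \<times> carrier G.
                inv\<^bsub>G\<^esub> g \<otimes>\<^bsub>G\<^esub> h \<in> V \<and> g \<otimes>\<^bsub>G\<^esub> inv\<^bsub>G\<^esub> h \<in> V} \<subseteq> E"
      unfolding two_sided_uniformity_def by (elim CollectE conjE bexE)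
    obtain W where W: "openin ?T W" "\<one>\<^bsub>G\<^esub> \<in> W" "W \<subseteq> V"
      using V unfolding identity_neighbourhoods_def by (elim CollectE conjE exE)
    have "generate_topology_on ?S W"
      using W(1) unfolding free_group_topology_def openin_topology_generated_by_iff .
    from ent[OF this W(2)] obtain U where U: "U \<in> \<U>" "?P U W"
      by (rule bexE)
    have "U \<subseteq> X \<times> X"
      using uniform_space_on_subset[OF unif U(1)] .
    have "(free_generator x, free_generator y) \<in> E" if "(x, y) \<in> U" for x y
    proof -
      have "free_generator x \<in> carrier G" "free_generator y \<in> carrier G"
        using that \<open>U \<subseteq> X \<times> X\<close> free_generator_carrier[of _ X] by (auto simp: G_def)
      then show ?thesis
        using that U(2) W(3) by (intro subsetD[OF E]) auto
    qed
    then show "\<exists>U\<in>\<U>. \<forall>(x, y)\<in>U. (free_generator x, free_generator y) \<in> E"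
      using U(1) by blast
  qed
  ultimately show ?thesis
    by (simp add: free_group_topology_candidate_def G_def)
qed

end

theory Submission
  imports Defs "HOL-Library.Nat_Bijection"
begin

text \<open>
  Let \<open>N(s)\<close> be the set of products of conjugates \<open>h x y^-1 h^-1\<close> of quotients of generators, where
  \<open>(x, y)\<close> lies in the entourage of \<open>s \<in> \<U>\<^sup>\<omega>\<close> whose index encodes a pair \<open>(n, k)\<close> with
  \<open>|h| \<le> n\<close>, and no \<open>k\<close> is used twice. The sets \<open>N(s)\<close> form a base at the identity of a group
  topology. It is Hausdorff, because \<open>F(X)\<close> acts on the real line by 3-Lipschitz homeomorphisms
  depending uniformly on the generators, and so that a given reduced word moves some point by at
  least 1, whereas for suitable \<open>s\<close> all elements of \<open>N(s)\<close> move points by less than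
  \<open>1/2 + 1/4 + 1/8 + ... = 1\<close>. Hence \<open>N(s)\<close> is a neighbourhood of the identity of \<open>F(X, \<U>)\<close>.

  Precompactness below \<open>add(\<U>)\<close> gives, by induction on \<open>n\<close>, for every neighbourhood \<open>W\<close> and every
  \<open>n\<close> an entourage \<open>U\<close> with \<open>h x y^-1 h^-1 \<in> W\<close> for all \<open>(x, y) \<in> U\<close> and \<open>|h| \<le> n\<close>: the first letter
  of \<open>h\<close> may be replaced by one of fewer than \<open>add(\<U>)\<close> letters. So each \<open>W\<close> contains some \<open>N(s)\<close>,
  and the monotone map \<open>s \<mapsto> N(s)\<close> has cofinal image. Conversely, \<open>W\<close> is mapped to the sequence of
  entourages \<open>{(x, y). (x y^-1)^(2^n) \<in> W}\<close>. Given \<open>t \<in> \<U>\<^sup>\<omega>\<close>, take a pseudometric \<open>d\<close> with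
  \<open>{d < 2^-n} \<subseteq> t n\<close>, and \<open>s\<close> such that \<open>N(s)\<close> displaces points by less than 1 whenever generators
  act \<open>d\<close>-uniformly. As \<open>(x y^-1)^m\<close> acts as translation by \<open>m * d x y\<close> when each generator \<open>z\<close> acts as
  translation by \<open>d z y\<close>, the sequence of \<open>N(s)\<close> refines \<open>t\<close>.
\<close>

section \<open>Pseudometrics subordinate to a sequence of entourages\<close>

text \<open>A link may use any \<open>k\<close> with \<open>(x, y) \<in> R k\<close> and costs
  \<open>(1/2)^k\<close>. The length is recorded because the metrization argument inducts on
  it.\<close>

inductive weighted_chain :: "(nat \<Rightarrow> 'b rel) \<Rightarrow> nat \<Rightarrow> 'b \<Rightarrow> 'b \<Rightarrow> real \<Rightarrow> bool"
  for R where
  refl: "weighted_chain R 0 x x 0"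
| step: "\<lbrakk>(x, y) \<in> R k; weighted_chain R n y z r\<rbrakk> \<Longrightarrow> weighted_chain R (Suc n) x z ((1/2)^k + r)"

lemma weighted_chain_nonneg: "weighted_chain R n x y r \<Longrightarrow> 0 \<le> r"
  by (induction rule: weighted_chain.induct) auto

lemma weighted_chain_single: "(x, y) \<in> R k \<Longrightarrow> weighted_chain R 1 x y ((1/2)^k)"
  using weighted_chain.step[OF _ weighted_chain.refl] by fastforce

lemma weighted_chain_trans:
  "weighted_chain R n x y r \<Longrightarrow> weighted_chain R m y z q \<Longrightarrow> weighted_chain R (n + m) x z (r + q)"
  by (induction rule: weighted_chain.induct) (auto simp: add.assoc intro: weighted_chain.step)

lemma weighted_chain_sym:
  assumes "\<And>k. sym (R k)" "weighted_chain R n x y r"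
  shows "weighted_chain R n y x r"
  using assms(2)
proof (induction rule: weighted_chain.induct)
  case (step x y k n z r)
  have "weighted_chain R 1 y x ((1/2)^k)"
    using assms(1) step(1) by (intro weighted_chain_single) (auto dest: symD)
  from weighted_chain_trans[OF step(3) this] show ?case
    by (simp add: add.commute)
qed (rule weighted_chain.refl)

text \<open>Walking along the chain, there is a first link at which the accumulated weight exceeds
  \<open>c\<close>. The pieces before and after it, of weights \<open>a\<close> and
  \<open>b\<close>, are strictly shorter, as induction on the length requires.\<close>

lemma weighted_chain_split:
  assumes "weighted_chain R n x y r" "0 \<le> c" "c < r"
  shows "\<exists>p u a k v q b. weighted_chain R p x u a \<and> (u, v) \<in> R k \<and> weighted_chain R q v y b \<and>
           p < n \<and> q < n \<and> r = a + (1/2)^k + b \<and> a \<le> c \<and> c < a + (1/2)^k"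
  using assms
proof (induction arbitrary: c rule: weighted_chain.induct)
  case (refl x)
  then show ?case by simp
next
  case (step x y k n z r)
  show ?case
  proof (cases "c < (1/2)^k")
    case True
    then have "weighted_chain R 0 x x 0 \<and> (x, y) \<in> R k \<and> weighted_chain R n y z r \<and>
      0 < Suc n \<and> n < Suc n \<and> (1/2)^k + r = 0 + (1/2)^k + r \<and> 0 \<le> c \<and> c < 0 + (1/2)^k"
      using step by (auto intro: weighted_chain.refl)
    then show ?thesis by blast
  next
    case False
    then obtain p u a k' v q b where *: "weighted_chain R p y u a" "(u, v) \<in> R k'"
      "weighted_chain R q v z b" "p < n" "q < n" "r = a + (1/2)^k' + b" "a \<le> c - (1/2)^k"
      "c - (1/2)^k < a + (1/2)^k'"
      using step.IH[of "c - (1/2)^k"] step.prems by auto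
    then have "weighted_chain R (Suc p) x u ((1/2)^k + a) \<and> (u, v) \<in> R k' \<and>
      weighted_chain R q v z b \<and> Suc p < Suc n \<and> q < Suc n \<and>
      (1/2)^k + r = ((1/2)^k + a) + (1/2)^k' + b \<and> (1/2)^k + a \<le> c \<and> c < (1/2)^k + a + (1/2)^k'"
      using step.hyps by (auto intro: weighted_chain.step)
    then show ?thesis by blast
  qed
qed

text \<open>
  Frink's metrization argument: cut the chain at the link where half of the weight is exceeded.
\<close>
lemma weighted_chain_less:
  assumes refl: "\<And>k. Id \<subseteq> R k" and cube: "\<And>k. R (Suc k) O R (Suc k) O R (Suc k) \<subseteq> R k"
    and "weighted_chain R n x y r" "r < (1/2)^k"
  shows "(x, y) \<in> R k"
  using assms(3,4)
proof (induction n arbitrary: x y r k rule: less_induct)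
  case (less n)
  have "R (Suc j) \<subseteq> R j" for j
    using refl[of "Suc j"] cube[of j] by fastforce
  then have anti: "R j \<subseteq> R i" if "i \<le> j" for i j
    using that by (rule lift_Suc_antimono_le)
  show ?case
  proof (cases "0 < r")
    case False
    with less.prems(1) show ?thesis
    proof cases
      case refl
      then show ?thesis using assms(1) by blast
    next
      case (step y k n r)
      then show ?thesis
        using False weighted_chain_nonneg[OF step(4)] zero_less_power[of "1/2::real" k] by linarith
    qed
  next
    case True
    then obtain p u a j v q b where *: "weighted_chain R p x u a" "(u, v) \<in> R j"
      "weighted_chain R q v y b" "p < n" "q < n" "r = a + (1/2)^j + b" "a \<le> r / 2" "r / 2 < a + (1/2)^j"
      using weighted_chain_split[OF less.prems(1), of "r/2"] by auto
    \<comment> \<open>Both outer pieces weigh at most \<open>r / 2\<close>, hence less than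
      \<open>(1/2)^Suc k\<close>. The cut link weighs at most \<open>r\<close>, so its index exceeds
      \<open>k\<close>. Thus all three pieces lie in \<open>R (Suc k)\<close>.\<close>
    have half: "(1/2)^k = 2 * (1/2::real)^Suc k"
      by simp
    have "0 \<le> a" "0 \<le> b"
      using * weighted_chain_nonneg by auto
    then have "(1/2::real)^j < (1/2)^k"
      using * less.prems(2) by linarith
    then have "k < j"
      by (simp add: power_strict_decreasing_iff)
    then have "(u, v) \<in> R (Suc k)"
      using *(2) anti[of "Suc k" j] by auto
    moreover have "(x, u) \<in> R (Suc k)"
      using less.IH[OF *(4) *(1), of "Suc k"] * less.prems(2) half by linarith
    moreover have "(v, y) \<in> R (Suc k)"
      using less.IH[OF *(5) *(3), of "Suc k"] * less.prems(2) half by linarith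
    ultimately show ?thesis
      using cube[of k] by blast
  qed
qed

text \<open>The condition \<open>R 0 = UNIV\<close> assumed below joins any two points by a chain of
  weight 1, so that the infimum is over a nonempty set bounded below by 0.\<close>

definition chain_dist :: "(nat \<Rightarrow> 'b rel) \<Rightarrow> 'b \<Rightarrow> 'b \<Rightarrow> real" where
  "chain_dist R x y = (INF r \<in> {r. \<exists>n. weighted_chain R n x y r}. r)"

context
  fixes R :: "nat \<Rightarrow> 'b rel"
  assumes R0: "R 0 = UNIV" and sym: "\<And>k. sym (R k)" and refl: "\<And>k. Id \<subseteq> R k"
    and cube: "\<And>k. R (Suc k) O R (Suc k) O R (Suc k) \<subseteq> R k"
begin

lemma chain_dist_le: "weighted_chain R n x y r \<Longrightarrow> chain_dist R x y \<le> r"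
  unfolding chain_dist_def
  by (rule cINF_lower) (auto intro!: bdd_belowI[of _ 0] simp: weighted_chain_nonneg)

lemma chain_dist_greatest: "(\<And>n r. weighted_chain R n x y r \<Longrightarrow> c \<le> r) \<Longrightarrow> c \<le> chain_dist R x y"
  unfolding chain_dist_def
  using weighted_chain_single[of x y R 0] by (intro cINF_greatest) (auto simp: R0)

lemma chain_dist_lessE:
  assumes "chain_dist R x y < c"
  obtains n r where "weighted_chain R n x y r" "r < c"
  using assms chain_dist_greatest[of x y c] by (metis not_le)

lemma chain_dist_nonneg: "0 \<le> chain_dist R x y"
  by (intro chain_dist_greatest) (rule weighted_chain_nonneg)

lemma chain_dist_same [simp]: "chain_dist R x x = 0"
  by (rule antisym[OF chain_dist_le[OF weighted_chain.refl] chain_dist_nonneg])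

lemma chain_dist_sym: "chain_dist R x y = chain_dist R y x"
proof -
  have "chain_dist R x y \<le> chain_dist R y x" for x y
    by (rule chain_dist_greatest, rule chain_dist_le, erule weighted_chain_sym[OF sym])
  then show ?thesis by (simp add: antisym)
qed

lemma chain_dist_triangle: "chain_dist R x z \<le> chain_dist R x y + chain_dist R y z"
proof -
  have "chain_dist R x z - r \<le> chain_dist R y z" if r: "weighted_chain R n x y r" for n r
  proof (rule chain_dist_greatest)
    fix m q assume "weighted_chain R m y z q"
    from chain_dist_le[OF weighted_chain_trans[OF r this]] show "chain_dist R x z - r \<le> q"
      by simp
  qed
  then have "chain_dist R x z - chain_dist R y z \<le> chain_dist R x y"
    by (intro chain_dist_greatest) (smt (verit))
  then show ?thesis by simp
qed

lemma chain_dist_link: "(x, y) \<in> R k \<Longrightarrow> chain_dist R x y \<le> (1/2)^k"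
  by (rule chain_dist_le[OF weighted_chain_single])

lemma chain_dist_less: "chain_dist R x y < (1/2)^k \<Longrightarrow> (x, y) \<in> R k"
  by (erule chain_dist_lessE) (rule weighted_chain_less[of R, OF refl cube])

end

section \<open>Entourages and uniform pseudometrics\<close>

locale uniform_space_carrier =
  fixes X :: "'a set" and \<U> :: "('a \<times> 'a) set set"
  assumes uniform: "uniform_space_on X \<U>"
begin

lemma entourage_subset: "V \<in> \<U> \<Longrightarrow> V \<subseteq> X \<times> X"
  using uniform by (rule uniform_space_on_subset)

lemma entourage_Int: "V \<in> \<U> \<Longrightarrow> W \<in> \<U> \<Longrightarrow> V \<inter> W \<in> \<U>"
  using uniform by (rule uniform_space_on_Int)

lemma entourage_conditions:
  "\<forall>V\<in>\<U>. V \<subseteq> X \<times> X \<and> sym V \<and> Id_on X \<subseteq> V"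
  "\<forall>V\<in>\<U>. \<forall>W. V \<subseteq> W \<and> W \<subseteq> X \<times> X \<and> sym W \<longrightarrow> W \<in> \<U>"
  "\<forall>V\<in>\<U>. \<exists>U\<in>\<U>. U O U \<subseteq> V"
  subgoal using uniform unfolding uniform_space_on_def by (elim conjE)
  subgoal using uniform unfolding uniform_space_on_def by (elim conjE)
  subgoal using uniform unfolding uniform_space_on_def by (elim conjE)
  done

lemma entourage_refl: "V \<in> \<U> \<Longrightarrow> x \<in> X \<Longrightarrow> (x, x) \<in> V"
  using entourage_conditions(1) Id_onI[of x X] by (meson subsetD)

lemma entourage_sym: "V \<in> \<U> \<Longrightarrow> sym V"
  using entourage_conditions(1) by simp

lemma entourage_symD: "V \<in> \<U> \<Longrightarrow> (x, y) \<in> V \<Longrightarrow> (y, x) \<in> V"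
  by (rule symD[OF entourage_sym])

lemma entourage_mono: "V \<in> \<U> \<Longrightarrow> V \<subseteq> W \<Longrightarrow> W \<subseteq> X \<times> X \<Longrightarrow> sym W \<Longrightarrow> W \<in> \<U>"
  using entourage_conditions(2) by meson

lemma entourage_full: "X \<times> X \<in> \<U>"
  using uniform unfolding uniform_space_on_def by (elim conjE)

lemma entourage_half: "V \<in> \<U> \<Longrightarrow> \<exists>U\<in>\<U>. U O U \<subseteq> V"
  using entourage_conditions(3) by simp

lemma Inter_entourages: "\<Inter>\<U> = Id_on X"
  using uniform unfolding uniform_space_on_def by (elim conjE)

lemma entourage_third:
  assumes V: "V \<in> \<U>"
  shows "\<exists>U\<in>\<U>. U O U O U \<subseteq> V"
proof -
  obtain W where W: "W \<in> \<U>" "W O W \<subseteq> V"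
    using entourage_half[OF V] by blast
  obtain U where U: "U \<in> \<U>" "U O U \<subseteq> W"
    using entourage_half[OF W(1)] by blast
  have "U \<subseteq> W"
    using U entourage_subset[OF U(1)] entourage_refl[OF U(1)] by blast
  then have "U O U O U \<subseteq> V"
    using U(2) W(2) by blast
  then show ?thesis
    using U(1) by blast
qed

text \<open>Separation supplies one entourage per pair, and finitely many are intersected. This will
  keep apart the generators occurring in a given word.\<close>

lemma entourage_avoiding:
  assumes "finite P" "P \<subseteq> X \<times> X" "\<And>x. (x, x) \<notin> P"
  shows "\<exists>V\<in>\<U>. V \<inter> P = {}"
  using assms
proof (induction P)
  case empty
  then show ?case using entourage_full by blast
next
  case (insert p P)
  have "\<exists>V\<in>\<U>. V \<inter> P = {}"
    using insert.prems by (intro insert.IH) auto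
  then obtain V where V: "V \<in> \<U>" "V \<inter> P = {}"
    by (elim bexE)
  have "p \<notin> \<Inter>\<U>"
    using insert.prems unfolding Inter_entourages by (metis Id_onE insertI1)
  then obtain W where "W \<in> \<U>" "p \<notin> W"
    by blast
  then have "V \<inter> W \<in> \<U>" "(V \<inter> W) \<inter> insert p P = {}"
    using V entourage_Int by auto
  then show ?case by blast
qed

text \<open>The metric axioms range over the whole type, because the actions on the line are defined
  for all letters of the type.\<close>

definition uniform_pseudometric :: "('a \<Rightarrow> 'a \<Rightarrow> real) \<Rightarrow> bool" where
  "uniform_pseudometric d \<longleftrightarrow>
     (\<forall>x. d x x = 0) \<and> (\<forall>x y. 0 \<le> d x y) \<and> (\<forall>x y. d x y = d y x) \<and>
     (\<forall>x y z. d x z \<le> d x y + d y z) \<and>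
     (\<forall>\<epsilon>>0. \<exists>U\<in>\<U>. \<forall>(x, y)\<in>U. d x y < \<epsilon>)"

lemma uniform_pseudometricD:
  assumes "uniform_pseudometric d"
  shows "d x x = 0" "0 \<le> d x y" "d x y = d y x" "d x z \<le> d x y + d y z"
  using assms unfolding uniform_pseudometric_def by auto

lemma uniform_pseudometric_small:
  assumes "uniform_pseudometric d" "0 < \<epsilon>"
  shows "\<exists>U\<in>\<U>. \<forall>(x, y)\<in>U. d x y < \<epsilon>"
  using assms unfolding uniform_pseudometric_def by simp

lemma uniform_pseudometric_scale:
  assumes d: "uniform_pseudometric d" and c: "0 < c"
  shows "uniform_pseudometric (\<lambda>x y. c * d x y)"
  unfolding uniform_pseudometric_def
proof (intro conjI allI impI)
  fix \<epsilon> :: real assume "0 < \<epsilon>"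
  then have "0 < \<epsilon> / c"
    using c by simp
  from uniform_pseudometric_small[OF d this] show "\<exists>U\<in>\<U>. \<forall>(x, y)\<in>U. c * d x y < \<epsilon>"
    using c by (simp add: pos_less_divide_eq mult.commute)
next
  fix x y z
  show "c * d x x = 0" "0 \<le> c * d x y" "c * d x y = c * d y x"
    using uniform_pseudometricD(1-3)[OF d] c by simp_all
  show "c * d x z \<le> c * d x y + c * d y z"
    using uniform_pseudometricD(4)[OF d] c by (simp flip: distrib_left)
qed

text \<open>A single pseudometric controls all \<open>t n\<close> at once; this lets one family of
  actions on the line test a whole sequence of entourages.\<close>

lemma exists_uniform_pseudometric:
  assumes t: "\<And>n. t n \<in> \<U>"
  obtains d where "uniform_pseudometric d"
    "\<And>n x y. \<lbrakk>x \<in> X; y \<in> X; d x y < (1/2)^n\<rbrakk> \<Longrightarrow> (x, y) \<in> t n"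
proof -
  have "\<exists>U. \<forall>n. (U n \<in> \<U> \<and> U n \<subseteq> t n) \<and> U (Suc n) O U (Suc n) O U (Suc n) \<subseteq> U n"
  proof (rule dependent_nat_choice)
    fix V n assume "V \<in> \<U> \<and> V \<subseteq> t n"
    then obtain W where "W \<in> \<U>" "W O W O W \<subseteq> V"
      using entourage_third by blast
    then show "\<exists>W. (W \<in> \<U> \<and> W \<subseteq> t (Suc n)) \<and> W O W O W \<subseteq> V"
      using entourage_Int[OF _ t[of "Suc n"]] by (intro exI[of _ "W \<inter> t (Suc n)"]) blast
  qed (use t[of 0] in blast)
  then obtain U where U: "\<And>n. U n \<in> \<U>" "\<And>n. U n \<subseteq> t n"
    "\<And>n. U (Suc n) O U (Suc n) O U (Suc n) \<subseteq> U n"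
    by metis
  \<comment> \<open>The index is shifted to make room for \<open>R 0 = UNIV\<close>, and
    \<open>Id\<close> is adjoined because entourages are reflexive only on \<open>X\<close>.\<close>
  define R where "R n = (case n of 0 \<Rightarrow> UNIV | Suc k \<Rightarrow> U k \<union> Id)" for n
  have R: "R 0 = UNIV" "\<And>k. R (Suc k) = U k \<union> Id"
    by (simp_all add: R_def)
  have R': "sym (R k)" "Id \<subseteq> R k" "R (Suc k) O R (Suc k) O R (Suc k) \<subseteq> R k" for k
  proof -
    show "sym (R k)"
      using entourage_sym[OF U(1)] by (cases k) (auto simp: R sym_Un sym_Id sym_def)
    show "Id \<subseteq> R k"
      by (cases k) (auto simp: R)
    show "R (Suc k) O R (Suc k) O R (Suc k) \<subseteq> R k"
    proof (cases k)
      case (Suc j)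
      have "(x, y) \<in> U j" if "(x, y) \<in> U k" for x y
        using that entourage_subset[OF U(1)[of k]] entourage_refl[OF U(1)[of k]] U(3)[of j]
        unfolding Suc by blast
      moreover have "(x, z) \<in> U j" if "(x, y) \<in> U k" "(y, z) \<in> U k" for x y z
        using that entourage_subset[OF U(1)[of k]] entourage_refl[OF U(1)[of k]] U(3)[of j]
        unfolding Suc by blast
      moreover have "(x, w) \<in> U j" if "(x, y) \<in> U k" "(y, z) \<in> U k" "(z, w) \<in> U k" for x y z w
        using that U(3)[of j] unfolding Suc by blast
      ultimately show ?thesis
        unfolding Suc R by (auto simp: Suc)
    qed (simp add: R)
  qed
  note dist = chain_dist_nonneg[of R, OF R(1) R'] chain_dist_same[of R, OF R(1) R']
    chain_dist_sym[of R, OF R(1) R'] chain_dist_triangle[of R, OF R(1) R']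
    chain_dist_link[of R, OF R(1) R'] chain_dist_less[of R, OF R(1) R']
  have d: "uniform_pseudometric (chain_dist R)"
    unfolding uniform_pseudometric_def
  proof (intro conjI allI impI)
    fix \<epsilon> :: real assume "0 < \<epsilon>"
    then obtain n where n: "(1/2)^n < \<epsilon>"
      using real_arch_pow_inv[of \<epsilon> "1/2"] by auto
    have "\<forall>(x, y)\<in>U n. chain_dist R x y < \<epsilon>"
    proof safe
      fix x y assume "(x, y) \<in> U n"
      then have "chain_dist R x y \<le> (1/2)^Suc n"
        by (intro dist(5)) (simp add: R)
      also have "\<dots> \<le> (1/2)^n"
        by simp
      finally show "chain_dist R x y < \<epsilon>"
        using n by simp
    qed
    then show "\<exists>U\<in>\<U>. \<forall>(x, y)\<in>U. chain_dist R x y < \<epsilon>"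
      using U(1) by blast
  qed (simp_all only: dist(1,2) dist(4), rule dist(3))
  show ?thesis
  proof
    \<comment> \<open>Doubling undoes the index shift: \<open>2 * chain_dist R x y < (1/2)^n\<close>
      places the pair in \<open>R (Suc n)\<close>, that is, in \<open>U n\<close> or on the
      diagonal.\<close>
    show "uniform_pseudometric (\<lambda>x y. 2 * chain_dist R x y)"
      by (rule uniform_pseudometric_scale[OF d]) simp
    fix n x y assume "x \<in> X" "y \<in> X" "2 * chain_dist R x y < (1/2)^n"
    then show "(x, y) \<in> t n"
      using dist(6)[of x y "Suc n"] entourage_refl[OF U(1)] U(2)[of n] by (auto simp: R)
  qed
qed

end

section \<open>Lipschitz actions of the free group on the line\<close>

text \<open>Cancelling an adjacent inverse pair does not change the composite map, so letters acting
  through \<open>foldr\<close> define an action of the free group.\<close>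

lemma foldr_letter_mult_action:
  assumes "\<And>l t. \<phi> l (\<phi> (inverse_letter l) t) = t"
  shows "foldr \<phi> (foldr letter_mult u v) t = foldr \<phi> u (foldr \<phi> v t)"
proof -
  have "foldr \<phi> (letter_mult l w) t = \<phi> l (foldr \<phi> w t)" for l w
    by (cases w) (auto simp: assms)
  then show ?thesis
    by (induction u) auto
qed

text \<open>
  The constant 3 is the least slope bound that allows two integers at distance 1 to move apart, and
  two integers at distance 3 to move together, by 1 each.
\<close>
definition lipschitz_action :: "('a \<Rightarrow> 'a \<Rightarrow> real) \<Rightarrow> ('a \<times> bool \<Rightarrow> real \<Rightarrow> real) \<Rightarrow> bool" where
  "lipschitz_action d \<phi> \<longleftrightarrow>
     (\<forall>l t. \<phi> l (\<phi> (inverse_letter l) t) = t) \<and>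
     (\<forall>l t u. \<bar>\<phi> l t - \<phi> l u\<bar> \<le> 3 * \<bar>t - u\<bar>) \<and>
     (\<forall>x y t. \<bar>\<phi> (x, True) t - \<phi> (y, True) t\<bar> \<le> d x y)"

lemma lipschitz_actionD:
  assumes "lipschitz_action d \<phi>"
  shows "\<phi> l (\<phi> (inverse_letter l) t) = t" "\<bar>\<phi> l t - \<phi> l u\<bar> \<le> 3 * \<bar>t - u\<bar>"
    "\<bar>\<phi> (x, True) t - \<phi> (y, True) t\<bar> \<le> d x y"
  using assms unfolding lipschitz_action_def by blast+

lemma lipschitz_action_word:
  assumes "lipschitz_action d \<phi>"
  shows "\<bar>foldr \<phi> w t - foldr \<phi> w u\<bar> \<le> 3 ^ length w * \<bar>t - u\<bar>"
proof (induction w)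
  case (Cons l w)
  have "\<bar>\<phi> l (foldr \<phi> w t) - \<phi> l (foldr \<phi> w u)\<bar> \<le> 3 * \<bar>foldr \<phi> w t - foldr \<phi> w u\<bar>"
    using assms by (rule lipschitz_actionD)
  also have "\<dots> \<le> 3 * (3 ^ length w * \<bar>t - u\<bar>)"
    using Cons.IH by simp
  finally show ?case by simp
qed simp

text \<open>Increasing with difference quotients between 1/3 and 3: the lower bound makes the
  inverse 3-Lipschitz too. Stated for ordered pairs, the condition passes to minima and
  maxima.\<close>

definition slope_bounded :: "(real \<Rightarrow> real) \<Rightarrow> bool" where
  "slope_bounded f \<longleftrightarrow> (\<forall>t u. t \<le> u \<longrightarrow> (u - t) / 3 \<le> f u - f t \<and> f u - f t \<le> 3 * (u - t))"

lemma slope_bounded_add_const: "slope_bounded (\<lambda>t. t + c)"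
  by (auto simp: slope_bounded_def)

lemma slope_bounded_min:
  "slope_bounded f \<Longrightarrow> slope_bounded g \<Longrightarrow> slope_bounded (\<lambda>t. min (f t) (g t))"
  unfolding slope_bounded_def by (smt (verit))

lemma slope_bounded_max:
  "slope_bounded f \<Longrightarrow> slope_bounded g \<Longrightarrow> slope_bounded (\<lambda>t. max (f t) (g t))"
  unfolding slope_bounded_def by (smt (verit))

lemma slope_bounded_abs:
  assumes "slope_bounded f"
  shows "\<bar>f t - f u\<bar> \<le> 3 * \<bar>t - u\<bar>" "\<bar>t - u\<bar> \<le> 3 * \<bar>f t - f u\<bar>"
proof -
  have *: "t \<le> u \<Longrightarrow> (u - t) / 3 \<le> f u - f t \<and> f u - f t \<le> 3 * (u - t)" for t u
    using assms unfolding slope_bounded_def by blast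
  show "\<bar>f t - f u\<bar> \<le> 3 * \<bar>t - u\<bar>" "\<bar>t - u\<bar> \<le> 3 * \<bar>f t - f u\<bar>"
    using *[of t u] *[of u t] by (cases "t \<le> u"; simp add: abs_if; linarith)+
qed

text \<open>The lower slope bound gives injectivity. Continuity and
  \<open>f (v - 1) \<le> v \<le> f (v + 1)\<close> give surjectivity by the intermediate value
  theorem.\<close>

lemma slope_bounded_bij:
  assumes f: "slope_bounded f" and near: "\<And>t. \<bar>f t - t\<bar> \<le> 1"
  shows "bij f"
proof (rule bijI)
  show "inj f"
    using slope_bounded_abs(2)[OF f] by (intro injI) (metis abs_0 abs_le_zero_iff diff_self eq_iff_diff_eq_0 mult_zero_right)
  have "isCont f t" for t
  proof -
    have "3-lipschitz_on UNIV f"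
      using slope_bounded_abs(1)[OF f] by (intro lipschitz_onI) (auto simp: dist_real_def)
    then show ?thesis
      using lipschitz_on_continuous_on continuous_on_eq_continuous_at open_UNIV by blast
  qed
  then have "\<exists>t. f t = v" for v
    using IVT[of f "v - 1" v "v + 1"] near[of "v - 1"] near[of "v + 1"] by (auto simp: abs_le_iff)
  then show "surj f"
    by (metis surjI surj_def)
qed

text \<open>The largest increment over a step \<open>u\<close> that \<open>slope_bounded\<close>
  permits: slope 3 to the right and 1/3 to the left.\<close>

definition kinked :: "real \<Rightarrow> real" where
  "kinked u = max (3 * u) (u / 3)"

lemma kinked_ge: "3 * u \<le> kinked u" "u / 3 \<le> kinked u" "u \<le> kinked u"
  by (auto simp: kinked_def le_max_iff_disj)

lemma slope_bounded_kinked: "slope_bounded (\<lambda>t. b + kinked (t - a) + c)"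
proof -
  have "slope_bounded (\<lambda>t. max (3 * t + (b - 3 * a + c)) (t / 3 + (b - a / 3 + c)))"
    by (rule slope_bounded_max) (simp_all add: slope_bounded_def)
  also have "(\<lambda>t. max (3 * t + (b - 3 * a + c)) (t / 3 + (b - a / 3 + c))) = (\<lambda>t. b + kinked (t - a) + c)"
    by (intro ext) (simp add: kinked_def max_def field_simps)
  finally show ?thesis .
qed

text \<open>
  A reduced word \<open>w\<close> is made to act by moving \<open>length w\<close> to \<open>0\<close> in unit steps. Letter \<open>w ! j\<close> has to
  move \<open>j + 1\<close> to \<open>j\<close>, which for each generator prescribes finitely many values of a function on the
  integers. Reducedness says that these prescriptions are consistent with a strictly increasing
  function; \<open>kinked\<close> then extends them to the line as in McShane's extension theorem, where the
  term \<open>d x (fst (w ! j))\<close> switches off the constraints of all other generators.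
\<close>
locale separating_word =
  fixes d :: "'a \<Rightarrow> 'a \<Rightarrow> real" and w :: "('a \<times> bool) list"
  assumes reduced: "reduced_word w"
    and d_same: "\<And>x. d x x = 0" and d_sym: "\<And>x y. d x y = d y x"
    and d_triangle: "\<And>x y z. d x z \<le> d x y + d y z"
    and d_nonneg: "\<And>x y. 0 \<le> d x y"
    and d_large: "\<And>l m. \<lbrakk>l \<in> set w; m \<in> set w; fst l \<noteq> fst m\<rbrakk> \<Longrightarrow> 2 * length w \<le> d (fst l) (fst m)"
begin

text \<open>An inverse letter moves \<open>Suc j\<close> to \<open>j\<close> exactly if its
  generator moves \<open>j\<close> to \<open>Suc j\<close>; hence \<open>source\<close> and
  \<open>target\<close> swap roles with the sign.\<close>

definition source :: "nat \<Rightarrow> nat" where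
  "source j = (if snd (w ! j) then Suc j else j)"

definition target :: "nat \<Rightarrow> nat" where
  "target j = (if snd (w ! j) then j else Suc j)"

text \<open>The largest value at \<open>t\<close> compatible with the prescription of letter
  \<open>j\<close>, the slope bounds, and a dependence on the generator that is 1-Lipschitz for
  \<open>d\<close>.\<close>

definition constraint :: "'a \<Rightarrow> nat \<Rightarrow> real \<Rightarrow> real" where
  "constraint x j t = real (target j) + kinked (t - real (source j)) + d x (fst (w ! j))"

definition lower_envelope :: "'a \<Rightarrow> nat list \<Rightarrow> real \<Rightarrow> real" where
  "lower_envelope x js t = foldr (\<lambda>j. min (constraint x j t)) js (t + 1)"

text \<open>Truncating to the band from \<open>t - 1\<close> to \<open>t + 1\<close> gives the
  nearness needed for surjectivity. Prescribed values survive, since \<open>source\<close> and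
  \<open>target\<close> differ by 1. The form \<open>t + - 1\<close> matches
  \<open>slope_bounded_add_const\<close>.\<close>

definition shift :: "'a \<Rightarrow> real \<Rightarrow> real" where
  "shift x t = max (t + - 1) (lower_envelope x [0..<length w] t)"

lemma slope_bounded_lower_envelope: "slope_bounded (lower_envelope x js)"
proof (induction js)
  case Nil
  show ?case
    using slope_bounded_add_const[of 1] by (simp add: lower_envelope_def[abs_def])
next
  case (Cons j js)
  have "slope_bounded (constraint x j)"
    unfolding constraint_def[abs_def] by (rule slope_bounded_kinked)
  from slope_bounded_min[OF this Cons.IH] show ?case
    by (simp add: lower_envelope_def[abs_def])
qed

lemma slope_bounded_shift: "slope_bounded (shift x)"
  unfolding shift_def[abs_def]
  by (rule slope_bounded_max[OF slope_bounded_add_const slope_bounded_lower_envelope])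

lemma d_lipschitz: "\<bar>d x z - d y z\<bar> \<le> d x y"
  using d_triangle[of x z y] d_triangle[of y z x] d_sym[of x y] by linarith

lemma shift_lipschitz: "\<bar>shift x t - shift y t\<bar> \<le> d x y"
proof -
  have "\<bar>lower_envelope x js t - lower_envelope y js t\<bar> \<le> d x y" for js
  proof (induction js)
    case (Cons j js)
    have "\<bar>constraint x j t - constraint y j t\<bar> \<le> d x y"
      using d_lipschitz by (simp add: constraint_def)
    then show ?case
      using Cons by (auto simp: lower_envelope_def min_def abs_if split: if_splits)
  qed (simp add: lower_envelope_def d_nonneg)
  from this[of "[0..<length w]"] show ?thesis
    by (auto simp: shift_def max_def abs_if split: if_splits)
qed

lemma lower_envelope_le: "lower_envelope x js t \<le> t + 1"
  by (induction js) (auto simp: lower_envelope_def min_le_iff_disj)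

lemma lower_envelope_le_constraint: "j \<in> set js \<Longrightarrow> lower_envelope x js t \<le> constraint x j t"
  by (induction js) (auto simp: lower_envelope_def min_le_iff_disj)

lemma lower_envelope_greatest:
  "\<lbrakk>v \<le> t + 1; \<And>j. j \<in> set js \<Longrightarrow> v \<le> constraint x j t\<rbrakk> \<Longrightarrow> v \<le> lower_envelope x js t"
  by (induction js) (auto simp: lower_envelope_def)

lemma shift_near: "\<bar>shift x t - t\<bar> \<le> 1"
  using lower_envelope_le[of x "[0..<length w]" t] by (auto simp: shift_def)

text \<open>Between distinct generators the distance term, at least \<open>2 * length w\<close>,
  outweighs everything, as sources and targets lie between 0 and \<open>length w\<close>. For one
  generator, equal signs give slope 1, and opposite signs do not occur at adjacent
  positions.\<close>

lemma constraint_consistent: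
  assumes "i < length w" "j < length w"
  shows "target i \<le> constraint (fst (w ! i)) j (source i)"
proof (cases "fst (w ! i) = fst (w ! j)")
  case False
  then have "2 * length w \<le> d (fst (w ! i)) (fst (w ! j))"
    using assms by (intro d_large) auto
  moreover have "real (target i) \<le> length w" "real (source i) \<le> length w" "real (source j) \<le> length w"
    using assms by (auto simp: target_def source_def)
  moreover have "- real (source j) \<le> kinked (real (source i) - real (source j))"
    by (simp add: kinked_def le_max_iff_disj)
  ultimately show ?thesis
    unfolding constraint_def using of_nat_0_le_iff[of "target j"] by linarith
next
  case True
  have adjacent: "snd (w ! k) = snd (w ! Suc k)"
    if "Suc k < length w" "fst (w ! k) = fst (w ! Suc k)" for k
    using reduced that successively_nth[of "\<lambda>l m. m \<noteq> inverse_letter l" w k]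
    by (auto simp: reduced_word_def inverse_letter_def prod_eq_iff)
  consider "snd (w ! i) = snd (w ! j)" | "snd (w ! i)" "\<not> snd (w ! j)" | "\<not> snd (w ! i)" "snd (w ! j)"
    by blast
  then have "real (target i) - target j \<le> kinked u" if u: "u = real (source i) - real (source j)" for u
  proof cases
    case 1
    then have "real (target i) - target j = real (source i) - source j"
      by (simp add: target_def source_def)
    then show ?thesis
      using kinked_ge(3)[of u] u by simp
  next
    case 2
    then have "j \<noteq> Suc i" "j \<noteq> i"
      using adjacent[of i] True assms by auto
    then have "real j + 1 \<le> real i \<or> real i + 2 \<le> real j"
      by linarith
    moreover have "real (source i) = real i + 1" "real (target i) = real i"
      "real (source j) = real j" "real (target j) = real j + 1"
      using 2 by (simp_all add: source_def target_def)
    ultimately show ?thesis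
      using kinked_ge(1,2)[of u] u by (elim disjE) linarith+
  next
    \<comment> \<open>Here the targets differ by \<open>u + 2\<close>. Reducedness excludes
      \<open>u\<close> = -2, -1 and 0; at \<open>u = 1\<close> and \<open>u = -3\<close> the
      required bound by \<open>kinked u\<close> is an equality, which is where the constant 3 comes
      from.\<close>
    case 3
    then have "i \<noteq> Suc j" "j \<noteq> i" "j \<noteq> Suc i"
      using adjacent[of j] adjacent[of i] True assms by auto
    then have "real j + 2 \<le> real i \<or> real i + 2 \<le> real j"
      by linarith
    moreover have "real (source i) = real i" "real (target i) = real i + 1"
      "real (source j) = real j + 1" "real (target j) = real j"
      using 3 by (simp_all add: source_def target_def)
    ultimately show ?thesis
      using kinked_ge(1,2)[of u] u by (elim disjE) linarith+
  qed
  then show ?thesis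
    by (simp add: constraint_def True d_same)
qed

text \<open>Constraint \<open>i\<close> is exact at its own source, and by consistency no other
  constraint cuts below its value.\<close>

lemma shift_source:
  assumes "i < length w"
  shows "shift (fst (w ! i)) (source i) = target i"
proof -
  have "lower_envelope (fst (w ! i)) [0..<length w] (source i) \<le> target i"
    using lower_envelope_le_constraint[of i "[0..<length w]" "fst (w ! i)" "source i"] assms
    by (simp add: constraint_def kinked_def d_same)
  moreover have "target i \<le> lower_envelope (fst (w ! i)) [0..<length w] (source i)"
    using constraint_consistent assms
    by (intro lower_envelope_greatest) (auto simp: target_def source_def)
  ultimately show ?thesis
    by (auto simp: shift_def target_def source_def)
qed

lemma bij_shift: "bij (shift x)"
  by (rule slope_bounded_bij[OF slope_bounded_shift shift_near])

definition letter_action :: "'a \<times> bool \<Rightarrow> real \<Rightarrow> real" where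
  "letter_action l = (if snd l then shift (fst l) else inv_into UNIV (shift (fst l)))"

lemma lipschitz_letter_action: "lipschitz_action d letter_action"
  unfolding lipschitz_action_def
proof (intro conjI allI)
  note inv = inv_f_f[OF bij_is_inj[OF bij_shift]] surj_f_inv_f[OF bij_is_surj[OF bij_shift]]
  fix l :: "'a \<times> bool" and t u
  show "letter_action l (letter_action (inverse_letter l) t) = t"
    by (simp add: letter_action_def inverse_letter_def inv)
  show "\<bar>letter_action l t - letter_action l u\<bar> \<le> 3 * \<bar>t - u\<bar>"
    using slope_bounded_abs(1)[OF slope_bounded_shift, of "fst l" t u]
      slope_bounded_abs(2)[OF slope_bounded_shift, of "inv_into UNIV (shift (fst l)) t" "inv_into UNIV (shift (fst l)) u" "fst l"]
    by (simp add: letter_action_def inv)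
next
  fix x y t
  show "\<bar>letter_action (x, True) t - letter_action (y, True) t\<bar> \<le> d x y"
    by (simp add: letter_action_def shift_lipschitz)
qed

lemma letter_action_step:
  assumes "i < length w"
  shows "letter_action (w ! i) (Suc i) = i"
  using shift_source[OF assms] inv_f_f[OF bij_is_inj[OF bij_shift], of "fst (w ! i)" i]
  by (auto simp: letter_action_def source_def target_def split: if_splits)

lemma letter_action_word: "foldr letter_action w (length w) = 0"
proof -
  \<comment> \<open>\<open>foldr\<close> applies the last letter first, so the induction runs over
    suffixes, from the empty one upwards.\<close>
  have "j \<le> length w \<Longrightarrow> foldr letter_action (drop j w) (length w) = j" for j
  proof (induction j rule: inc_induct)
    case (step j)
    then have "drop j w = w ! j # drop (Suc j) w"
      by (simp add: Cons_nth_drop_Suc)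
    then show ?case
      using step letter_action_step[of j] by simp
  qed simp
  from this[of 0] show ?thesis by simp
qed

end

section \<open>Group topologies from a neighbourhood base\<close>

text \<open>Open sets are those containing, with each point, a left translate of a base set.
  Condition \<open>nbhd\<close> makes the base sets and their left translates open themselves, so no
  interiors have to be taken.\<close>

lemma (in group) topological_group_of_base:
  assumes nonempty: "\<B> \<noteq> {}"
    and base: "\<And>B. B \<in> \<B> \<Longrightarrow> B \<subseteq> carrier G" "\<And>B. B \<in> \<B> \<Longrightarrow> \<one> \<in> B"
    and int: "\<And>A B. \<lbrakk>A \<in> \<B>; B \<in> \<B>\<rbrakk> \<Longrightarrow> \<exists>C\<in>\<B>. C \<subseteq> A \<inter> B"
    and mult: "\<And>B. B \<in> \<B> \<Longrightarrow> \<exists>C\<in>\<B>. \<forall>a\<in>C. \<forall>b\<in>C. a \<otimes> b \<in> B"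
    and inv: "\<And>B a. \<lbrakk>B \<in> \<B>; a \<in> B\<rbrakk> \<Longrightarrow> inv a \<in> B"
    and conj: "\<And>B g. \<lbrakk>B \<in> \<B>; g \<in> carrier G\<rbrakk> \<Longrightarrow> \<exists>C\<in>\<B>. \<forall>c\<in>C. g \<otimes> c \<otimes> inv g \<in> B"
    and nbhd: "\<And>B a. \<lbrakk>B \<in> \<B>; a \<in> B\<rbrakk> \<Longrightarrow> \<exists>C\<in>\<B>. \<forall>c\<in>C. a \<otimes> c \<in> B"
    and sep: "\<And>g. \<lbrakk>g \<in> carrier G; g \<noteq> \<one>\<rbrakk> \<Longrightarrow> \<exists>B\<in>\<B>. g \<notin> B"
  shows "\<exists>T. topological_group_on G T \<and>
    (\<forall>W. openin T W \<longleftrightarrow> W \<subseteq> carrier G \<and> (\<forall>g\<in>W. \<exists>B\<in>\<B>. \<forall>b\<in>B. g \<otimes> b \<in> W))"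
proof -
  have cancel: "g \<otimes> (inv g \<otimes> x) = x" "inv g \<otimes> (g \<otimes> x) = x"
    if "g \<in> carrier G" "x \<in> carrier G" for g x
    using that by (simp_all flip: m_assoc)
  define P where "P W \<longleftrightarrow> W \<subseteq> carrier G \<and> (\<forall>g\<in>W. \<exists>B\<in>\<B>. \<forall>b\<in>B. g \<otimes> b \<in> W)" for W
  define T where "T = topology P"
  have "istopology P"
    unfolding istopology_def
  proof (intro conjI allI impI)
    fix V W assume VW: "P V" "P W"
    show "P (V \<inter> W)"
      unfolding P_def
    proof (intro conjI ballI)
      fix g assume g: "g \<in> V \<inter> W"
      obtain A where A: "A \<in> \<B>" "\<forall>b\<in>A. g \<otimes> b \<in> V"
        using VW(1) g unfolding P_def by (meson IntD1)
      obtain B where B: "B \<in> \<B>" "\<forall>b\<in>B. g \<otimes> b \<in> W"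
        using VW(2) g unfolding P_def by (meson IntD2)
      obtain C where "C \<in> \<B>" "C \<subseteq> A \<inter> B"
        using int[OF A(1) B(1)] by (elim bexE)
      then show "\<exists>B\<in>\<B>. \<forall>b\<in>B. g \<otimes> b \<in> V \<inter> W"
        using A B by (intro bexI[of _ C]) auto
    qed (use VW in \<open>auto simp: P_def\<close>)
  next
    fix K assume "\<forall>V\<in>K. P V"
    then show "P (\<Union>K)"
      unfolding P_def by (meson UnionE UnionI Union_least)
  qed
  then have openin: "openin T W \<longleftrightarrow> P W" for W
    by (simp add: T_def topology_inverse')
  have "P (carrier G)"
    using nonempty base(1) unfolding P_def by (meson equals0I m_closed order_refl subsetD)
  then have top: "topspace T = carrier G"
    unfolding topspace_def openin using P_def by blast
  have translate: "P {x \<in> carrier G. inv g \<otimes> x \<in> B}" if gB: "g \<in> carrier G" "B \<in> \<B>" for g B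
    unfolding P_def
  proof (intro conjI ballI)
    fix x assume x: "x \<in> {x \<in> carrier G. inv g \<otimes> x \<in> B}"
    then obtain C where C: "C \<in> \<B>" "\<forall>c\<in>C. inv g \<otimes> x \<otimes> c \<in> B"
      using nbhd[OF gB(2), of "inv g \<otimes> x"] by auto
    moreover have "c \<in> carrier G" if "c \<in> C" for c
      using that C(1) base(1) by blast
    ultimately show "\<exists>C\<in>\<B>. \<forall>b\<in>C. x \<otimes> b \<in> {x \<in> carrier G. inv g \<otimes> x \<in> B}"
      using x \<open>g \<in> carrier G\<close> by (intro bexI[of _ C]) (auto simp: m_assoc)
  qed auto
  have "continuous_map (prod_topology T T) T (\<lambda>(x, y). x \<otimes> y)"
    unfolding continuous_map_def
  proof (intro conjI allI impI)
    fix W assume "openin T W"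
    then have W: "P W" by (simp add: openin)
    show "openin (prod_topology T T) {z \<in> topspace (prod_topology T T). (case z of (x, y) \<Rightarrow> x \<otimes> y) \<in> W}"
      unfolding openin_prod_topology_alt openin
    proof (intro allI impI)
      fix g h
      assume "(g, h) \<in> {z \<in> topspace (prod_topology T T). (case z of (x, y) \<Rightarrow> x \<otimes> y) \<in> W}"
      then have gh: "g \<in> carrier G" "h \<in> carrier G" "g \<otimes> h \<in> W"
        by (auto simp: top)
      obtain A where A: "A \<in> \<B>" "\<forall>a\<in>A. g \<otimes> h \<otimes> a \<in> W"
        using W gh(3) unfolding P_def by blast
      obtain B where B: "B \<in> \<B>" "\<forall>a\<in>B. \<forall>b\<in>B. a \<otimes> b \<in> A"
        using mult[OF A(1)] by blast
      \<comment> \<open>In \<open>x y = g h (h^-1 (g^-1 x) h) (h^-1 y)\<close> the deviation of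
        \<open>x\<close> from \<open>g\<close> appears conjugated by \<open>h^-1\<close>, which
        \<open>C\<close> has to absorb.\<close>
      obtain C where C: "C \<in> \<B>" "\<forall>c\<in>C. inv h \<otimes> c \<otimes> inv (inv h) \<in> B"
        using conj[OF B(1), of "inv h"] gh by blast
      let ?U = "{x \<in> carrier G. inv g \<otimes> x \<in> C}" and ?V = "{x \<in> carrier G. inv h \<otimes> x \<in> B}"
      have "x \<otimes> y \<in> W" if "x \<in> ?U" "y \<in> ?V" for x y
      proof -
        have "inv h \<otimes> (inv g \<otimes> x) \<otimes> h \<otimes> (inv h \<otimes> y) \<in> A"
          using that B C gh by fastforce
        then have "g \<otimes> h \<otimes> (inv h \<otimes> (inv g \<otimes> x) \<otimes> h \<otimes> (inv h \<otimes> y)) \<in> W"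
          using A(2) by blast
        then show ?thesis
          using that gh by (simp add: m_assoc cancel)
      qed
      then have "?U \<times> ?V \<subseteq> {z \<in> topspace (prod_topology T T). (case z of (x, y) \<Rightarrow> x \<otimes> y) \<in> W}"
        by (auto simp: top)
      moreover have "P ?U" "P ?V" "g \<in> ?U" "h \<in> ?V"
        using translate gh B C base(2) by auto
      ultimately show "\<exists>U V. P U \<and> P V \<and> g \<in> U \<and> h \<in> V \<and> U \<times> V \<subseteq>
          {z \<in> topspace (prod_topology T T). (case z of (x, y) \<Rightarrow> x \<otimes> y) \<in> W}"
        by blast
    qed
  qed (auto simp: top)
  moreover have "continuous_map T T (\<lambda>x. inv x)"
    unfolding continuous_map_def
  proof (intro conjI allI impI)
    fix W assume "openin T W"
    then have W: "P W" by (simp add: openin)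
    show "openin T {x \<in> topspace T. inv x \<in> W}"
      unfolding openin P_def top
    proof (intro conjI ballI)
      fix g assume "g \<in> {x \<in> carrier G. inv x \<in> W}"
      then have g: "g \<in> carrier G" "inv g \<in> W" by auto
      obtain A where A: "A \<in> \<B>" "\<forall>a\<in>A. inv g \<otimes> a \<in> W"
        using W g(2) unfolding P_def by blast
      obtain C where C: "C \<in> \<B>" "\<forall>c\<in>C. g \<otimes> c \<otimes> inv g \<in> A"
        using conj[OF A(1) g(1)] by blast
      have "inv (g \<otimes> c) \<in> W" "c \<in> carrier G" if "c \<in> C" for c
      proof -
        show c: "c \<in> carrier G"
          using that C(1) base(1) by blast
        have "inv g \<otimes> (g \<otimes> inv c \<otimes> inv g) \<in> W"
          using A(2) C(2) inv[OF C(1) that] by blast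
        then show "inv (g \<otimes> c) \<in> W"
          using g c by (simp add: m_assoc cancel inv_mult_group)
      qed
      then show "\<exists>C\<in>\<B>. \<forall>b\<in>C. g \<otimes> b \<in> {x \<in> carrier G. inv x \<in> W}"
        using C(1) g by (intro bexI[of _ C]) auto
    qed auto
  qed (auto simp: top)
  moreover have "Hausdorff_space T"
    unfolding Hausdorff_space_def top openin
  proof (intro allI impI)
    fix g h assume gh: "g \<in> carrier G \<and> h \<in> carrier G \<and> g \<noteq> h"
    then have "inv g \<otimes> h \<noteq> \<one>"
      by (metis inv_closed inv_equality inv_inv)
    then obtain B where B: "B \<in> \<B>" "inv g \<otimes> h \<notin> B"
      using sep[of "inv g \<otimes> h"] gh by auto
    obtain C where C: "C \<in> \<B>" "\<forall>a\<in>C. \<forall>b\<in>C. a \<otimes> b \<in> B"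
      using mult[OF B(1)] by blast
    let ?U = "{x \<in> carrier G. inv g \<otimes> x \<in> C}" and ?V = "{x \<in> carrier G. inv h \<otimes> x \<in> C}"
    have False if "x \<in> ?U" "x \<in> ?V" for x
    proof -
      \<comment> \<open>This product equals \<open>g^-1 h\<close>, which \<open>B\<close> was chosen
        to omit.\<close>
      have "inv g \<otimes> x \<otimes> inv (inv h \<otimes> x) \<in> B"
        using that C inv[OF C(1)] by blast
      then show False
        using B(2) that gh by (simp add: m_assoc cancel inv_mult_group)
    qed
    then have "disjnt ?U ?V"
      unfolding disjnt_def by blast
    moreover have "P ?U" "P ?V" "g \<in> ?U" "h \<in> ?V"
      using translate gh C base(2) by auto
    ultimately show "\<exists>U V. P U \<and> P V \<and> g \<in> U \<and> h \<in> V \<and> disjnt U V"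
      by blast
  qed
  ultimately have "topological_group_on G T"
    by (simp add: topological_group_on_def top is_group)
  then show ?thesis
    using openin unfolding P_def by blast
qed

section \<open>Small products of conjugates\<close>

lemma free_group_simps:
  "carrier (free_group X) = {w \<in> lists (X \<times> UNIV). reduced_word w}"
  "u \<otimes>\<^bsub>free_group X\<^esub> v = foldr letter_mult u v"
  "\<one>\<^bsub>free_group X\<^esub> = []"
  by (simp_all add: free_group_def)

lemma length_free_group_mult: "length (u \<otimes>\<^bsub>free_group X\<^esub> v) \<le> length u + length v"
proof -
  have "length (letter_mult l w) \<le> Suc (length w)" for l :: "'a \<times> bool" and w
    by (cases w) auto
  then show ?thesis
    unfolding free_group_simps by (induction u) (auto intro: le_trans)
qed

lemma letter_in_free_group: "x \<in> X \<Longrightarrow> [(x, b)] \<in> carrier (free_group X)"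
  by (simp add: free_group_simps reduced_word_def)

lemma inv_letter:
  assumes "x \<in> X"
  shows "inv\<^bsub>free_group X\<^esub> [(x, b)] = [(x, \<not> b)]"
proof -
  interpret group "free_group X"
    by (rule group_free_group)
  show ?thesis
    using assms by (intro inv_equality letter_in_free_group) (simp_all add: free_group_simps inverse_letter_def)
qed

sublocale uniform_space_carrier \<subseteq> group "free_group X"
  by (rule group_free_group)

context uniform_space_carrier
begin

abbreviation F where "F \<equiv> free_group X"

lemma generator_closed [simp]: "x \<in> X \<Longrightarrow> free_generator x \<in> carrier F"
  by (rule free_generator_carrier)

definition conj_quotient :: "('a \<times> bool) list \<Rightarrow> 'a \<Rightarrow> 'a \<Rightarrow> ('a \<times> bool) list" where
  "conj_quotient h x y =
     h \<otimes>\<^bsub>F\<^esub> (free_generator x \<otimes>\<^bsub>F\<^esub> inv\<^bsub>F\<^esub> free_generator y) \<otimes>\<^bsub>F\<^esub> inv\<^bsub>F\<^esub> h"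

lemma conj_quotient_closed [simp]:
  "\<lbrakk>h \<in> carrier F; x \<in> X; y \<in> X\<rbrakk> \<Longrightarrow> conj_quotient h x y \<in> carrier F"
  by (simp add: conj_quotient_def)

lemma inv_conj_quotient:
  "\<lbrakk>h \<in> carrier F; x \<in> X; y \<in> X\<rbrakk> \<Longrightarrow> inv\<^bsub>F\<^esub> conj_quotient h x y = conj_quotient h y x"
  by (simp add: conj_quotient_def inv_mult_group m_assoc)

lemma conj_conj_quotient:
  "\<lbrakk>g \<in> carrier F; h \<in> carrier F; x \<in> X; y \<in> X\<rbrakk> \<Longrightarrow>
     g \<otimes>\<^bsub>F\<^esub> conj_quotient h x y \<otimes>\<^bsub>F\<^esub> inv\<^bsub>F\<^esub> g = conj_quotient (g \<otimes>\<^bsub>F\<^esub> h) x y"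
  by (simp add: conj_quotient_def inv_mult_group m_assoc)

text \<open>
  The sequence \<open>s\<close> is indexed by pairs \<open>(n, k)\<close>: \<open>n\<close> bounds the length of the conjugating word, and
  each \<open>k\<close> is used for at most one factor.
\<close>
inductive small_product :: "(nat \<Rightarrow> 'a rel) \<Rightarrow> nat set \<Rightarrow> ('a \<times> bool) list \<Rightarrow> bool"
  for s where
  one: "small_product s {} \<one>\<^bsub>F\<^esub>"
| mult: "\<lbrakk>small_product s K g; k \<notin> K; h \<in> carrier F; length h \<le> n;
    (x, y) \<in> s (prod_encode (n, k)); x \<in> X; y \<in> X\<rbrakk> \<Longrightarrow>
    small_product s (insert k K) (conj_quotient h x y \<otimes>\<^bsub>F\<^esub> g)"

lemma small_product_closed: "small_product s K g \<Longrightarrow> g \<in> carrier F"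
  by (induction rule: small_product.induct) auto

lemma small_product_finite: "small_product s K g \<Longrightarrow> finite K"
  by (induction rule: small_product.induct) auto

lemma small_product_single:
  "\<lbrakk>h \<in> carrier F; length h \<le> n; (x, y) \<in> s (prod_encode (n, k)); x \<in> X; y \<in> X\<rbrakk> \<Longrightarrow>
    small_product s {k} (conj_quotient h x y)"
  using small_product.mult[OF small_product.one, of k h n x y] by simp

lemma small_product_mult:
  assumes "small_product s K g" "small_product s L h" "K \<inter> L = {}"
  shows "small_product s (K \<union> L) (g \<otimes>\<^bsub>F\<^esub> h)"
  using assms
proof (induction rule: small_product.induct)
  case one
  then show ?case using small_product_closed by simp
next
  case (mult K g k a n x y)
  have "small_product s (insert k (K \<union> L)) (conj_quotient a x y \<otimes>\<^bsub>F\<^esub> (g \<otimes>\<^bsub>F\<^esub> h))"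
    using mult by (intro small_product.mult) auto
  then show ?case
    using mult small_product_closed by (simp add: m_assoc)
qed

text \<open>Inversion reverses the order of the factors and swaps \<open>x\<close> with
  \<open>y\<close>. No order is imposed on the indices \<open>k\<close>, so the same
  \<open>K\<close> serves.\<close>

lemma small_product_inv:
  assumes "\<And>i. sym (s i)" "small_product s K g"
  shows "small_product s K (inv\<^bsub>F\<^esub> g)"
  using assms(2)
proof (induction rule: small_product.induct)
  case one
  show ?case using small_product.one by simp
next
  case (mult K g k h n x y)
  have "small_product s {k} (conj_quotient h y x)"
    using mult assms(1) by (intro small_product_single) (auto dest: symD)
  from small_product_mult[OF mult.IH this] show ?case
    using mult small_product_closed by (simp add: inv_mult_group inv_conj_quotient)
qed

text \<open>Conjugation by \<open>a\<close> lengthens every conjugating word by at most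
  \<open>p\<close>, and an injective \<open>f\<close> keeps the renumbered indices distinct. The
  case \<open>p = 0\<close> is mere renumbering.\<close>

lemma small_product_conj:
  assumes st: "\<And>n k x y. (x, y) \<in> s (prod_encode (n, k)) \<Longrightarrow> (x, y) \<in> t (prod_encode (n + p, f k))"
    and a: "a \<in> carrier F" "length a \<le> p" and f: "inj f"
    and "small_product s K g"
  shows "small_product t (f ` K) (a \<otimes>\<^bsub>F\<^esub> g \<otimes>\<^bsub>F\<^esub> inv\<^bsub>F\<^esub> a)"
  using assms(5)
proof (induction rule: small_product.induct)
  case one
  show ?case using a small_product.one by simp
next
  case (mult K g k h n x y)
  have "length (a \<otimes>\<^bsub>F\<^esub> h) \<le> n + p"
    using length_free_group_mult[of X a h] a mult by linarith
  then have "small_product t (insert (f k) (f ` K))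
      (conj_quotient (a \<otimes>\<^bsub>F\<^esub> h) x y \<otimes>\<^bsub>F\<^esub> (a \<otimes>\<^bsub>F\<^esub> g \<otimes>\<^bsub>F\<^esub> inv\<^bsub>F\<^esub> a))"
    using mult a st f by (intro small_product.mult[where n = "n + p"]) (auto simp: inj_image_mem_iff)
  moreover have "conj_quotient (a \<otimes>\<^bsub>F\<^esub> h) x y \<otimes>\<^bsub>F\<^esub> (a \<otimes>\<^bsub>F\<^esub> g \<otimes>\<^bsub>F\<^esub> inv\<^bsub>F\<^esub> a) =
      a \<otimes>\<^bsub>F\<^esub> (conj_quotient h x y \<otimes>\<^bsub>F\<^esub> g) \<otimes>\<^bsub>F\<^esub> inv\<^bsub>F\<^esub> a"
  proof -
    have "inv\<^bsub>F\<^esub> a \<otimes>\<^bsub>F\<^esub> (a \<otimes>\<^bsub>F\<^esub> z) = z" if "z \<in> carrier F" for z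
      using that a by (simp flip: m_assoc)
    then show ?thesis
      using mult a small_product_closed by (simp flip: conj_conj_quotient add: m_assoc)
  qed
  ultimately show ?case by simp
qed

lemma small_product_reindex:
  assumes "\<And>n k x y. (x, y) \<in> s (prod_encode (n, k)) \<Longrightarrow> (x, y) \<in> t (prod_encode (n, f k))"
    and "inj f" "small_product s K g"
  shows "small_product t (f ` K) g"
proof -
  have "small_product t (f ` K) (\<one>\<^bsub>F\<^esub> \<otimes>\<^bsub>F\<^esub> g \<otimes>\<^bsub>F\<^esub> inv\<^bsub>F\<^esub> \<one>\<^bsub>F\<^esub>)"
  proof (rule small_product_conj[of s t 0])
    show "(x, y) \<in> t (prod_encode (n + 0, f k))" if "(x, y) \<in> s (prod_encode (n, k))" for n k x y
      using assms(1) that by simp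
    show "length \<one>\<^bsub>F\<^esub> \<le> 0"
      by (simp add: free_group_simps)
  qed (fact one_closed assms(2,3))+
  then show ?thesis
    using small_product_closed[OF assms(3)] by simp
qed

section \<open>Base axioms for the sets of small products\<close>

definition small_products :: "(nat \<Rightarrow> 'a rel) \<Rightarrow> ('a \<times> bool) list set" where
  "small_products s = {g. \<exists>K. small_product s K g}"

lemma small_productsI: "small_product s K g \<Longrightarrow> g \<in> small_products s"
  unfolding small_products_def by blast

lemma small_products_subset: "small_products s \<subseteq> carrier F"
  using small_product_closed by (auto simp: small_products_def)

lemma one_in_small_products: "\<one>\<^bsub>F\<^esub> \<in> small_products s"
  using small_product.one by (auto simp: small_products_def)

lemma small_products_mono:
  assumes "\<And>i. s i \<subseteq> t i"
  shows "small_products s \<subseteq> small_products t"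
proof
  fix g assume "g \<in> small_products s"
  then obtain K where K: "small_product s K g"
    by (auto simp: small_products_def)
  have "small_product t (id ` K) g"
    by (rule small_product_reindex[OF _ inj_on_id K]) (use assms in auto)
  then show "g \<in> small_products t"
    by (auto simp: small_products_def)
qed

lemma small_products_mult:
  assumes s: "\<forall>i. s i \<in> \<U>"
  shows "\<exists>t. (\<forall>i. t i \<in> \<U>) \<and>
    (\<forall>a\<in>small_products t. \<forall>b\<in>small_products t. a \<otimes>\<^bsub>F\<^esub> b \<in> small_products s)"
proof (intro exI conjI allI ballI)
  \<comment> \<open>Factors of \<open>a\<close> move to even indices and factors of \<open>b\<close>
    to odd ones, so that none is used twice.\<close>
  define t where "t i = (case prod_decode i of (n, k) \<Rightarrow>
    s (prod_encode (n, 2 * k)) \<inter> s (prod_encode (n, 2 * k + 1)))" for i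
  show "t i \<in> \<U>" for i
    by (auto simp: t_def s entourage_Int split: prod.splits)
  fix a b assume "a \<in> small_products t" "b \<in> small_products t"
  then obtain K L where K: "small_product t K a" and L: "small_product t L b"
    by (auto simp: small_products_def)
  have "small_product s ((\<lambda>k. 2 * k) ` K) a"
    by (rule small_product_reindex[OF _ _ K]) (simp_all add: t_def inj_def)
  moreover have "small_product s ((\<lambda>k. 2 * k + 1) ` L) b"
    by (rule small_product_reindex[OF _ _ L]) (simp_all add: t_def inj_def)
  moreover have "2 * k \<noteq> 2 * l + 1" for k l :: nat
    by presburger
  then have "(\<lambda>k. 2 * k) ` K \<inter> (\<lambda>k. 2 * k + 1) ` L = {}"
    by blast
  ultimately show "a \<otimes>\<^bsub>F\<^esub> b \<in> small_products s"
    by (rule small_productsI[OF small_product_mult])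
qed

lemma small_products_conj:
  assumes s: "\<forall>i. s i \<in> \<U>" and g: "g \<in> carrier F"
  shows "\<exists>t. (\<forall>i. t i \<in> \<U>) \<and>
    (\<forall>a\<in>small_products t. g \<otimes>\<^bsub>F\<^esub> a \<otimes>\<^bsub>F\<^esub> inv\<^bsub>F\<^esub> g \<in> small_products s)"
proof (intro exI conjI allI ballI)
  \<comment> \<open>Conjugating words grow by up to \<open>length g\<close>, so \<open>t\<close>
    reads \<open>s\<close> at a correspondingly larger first index.\<close>
  define t where "t i = (case prod_decode i of (n, k) \<Rightarrow> s (prod_encode (n + length g, k)))" for i
  show "t i \<in> \<U>" for i
    by (auto simp: t_def s split: prod.splits)
  fix a assume "a \<in> small_products t"
  then obtain K where K: "small_product t K a"
    by (auto simp: small_products_def)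
  have "small_product s (id ` K) (g \<otimes>\<^bsub>F\<^esub> a \<otimes>\<^bsub>F\<^esub> inv\<^bsub>F\<^esub> g)"
    by (rule small_product_conj[OF _ g order_refl inj_on_id K]) (simp add: t_def)
  then show "g \<otimes>\<^bsub>F\<^esub> a \<otimes>\<^bsub>F\<^esub> inv\<^bsub>F\<^esub> g \<in> small_products s"
    by (auto simp: small_products_def)
qed

text \<open>A given \<open>g\<close> occupies only finitely many indices; the further factors are
  renumbered beyond all of them.\<close>

lemma small_products_neighbourhood:
  assumes s: "\<forall>i. s i \<in> \<U>" and g: "g \<in> small_products s"
  shows "\<exists>t. (\<forall>i. t i \<in> \<U>) \<and> (\<forall>a\<in>small_products t. g \<otimes>\<^bsub>F\<^esub> a \<in> small_products s)"
proof -
  obtain K where K: "small_product s K g"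
    using g by (auto simp: small_products_def)
  then obtain N where N: "\<And>k. k \<in> K \<Longrightarrow> k < N"
    using small_product_finite[OF K] unfolding finite_nat_set_iff_bounded by blast
  define t where "t i = (case prod_decode i of (n, k) \<Rightarrow> s (prod_encode (n, k + N)))" for i
  show ?thesis
  proof (intro exI conjI allI ballI)
    show "t i \<in> \<U>" for i
      by (auto simp: t_def s split: prod.splits)
    fix a assume "a \<in> small_products t"
    then obtain L where L: "small_product t L a"
      by (auto simp: small_products_def)
    have "small_product s ((\<lambda>k. k + N) ` L) a"
      by (rule small_product_reindex[OF _ _ L]) (simp_all add: t_def)
    moreover have "K \<inter> (\<lambda>k. k + N) ` L = {}"
      by (auto dest: N)
    ultimately show "g \<otimes>\<^bsub>F\<^esub> a \<in> small_products s"
      by (rule small_productsI[OF small_product_mult[OF K]])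
  qed
qed

end

section \<open>Displacement and separation\<close>

lemma sum_half_powers_less_1:
  assumes "finite K"
  shows "(\<Sum>k\<in>K. (1/2::real) ^ Suc k) < 1"
proof -
  obtain N where "K \<subseteq> {..<N}"
    using assms finite_nat_iff_bounded by blast
  then have "(\<Sum>k\<in>K. (1/2::real) ^ Suc k) \<le> (\<Sum>k<N. (1/2) ^ Suc k)"
    by (intro sum_mono2) auto
  also have "\<dots> = 1 - (1/2) ^ N"
    by (induction N) auto
  finally show ?thesis
    using zero_less_power[of "1/2::real" N] by linarith
qed

context uniform_space_carrier
begin

lemma action_mult:
  "lipschitz_action d \<phi> \<Longrightarrow> foldr \<phi> (u \<otimes>\<^bsub>F\<^esub> v) t = foldr \<phi> u (foldr \<phi> v t)"
  unfolding free_group_simps by (rule foldr_letter_mult_action) (rule lipschitz_actionD)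

lemma action_inv:
  assumes "lipschitz_action d \<phi>" "w \<in> carrier F"
  shows "foldr \<phi> w (foldr \<phi> (inv\<^bsub>F\<^esub> w) t) = t"
proof -
  have "foldr \<phi> w (foldr \<phi> (inv\<^bsub>F\<^esub> w) t) = foldr \<phi> \<one>\<^bsub>F\<^esub> t"
    using assms by (simp flip: action_mult)
  then show ?thesis
    by (simp add: free_group_simps)
qed

text \<open>Since \<open>y\<close> sends \<open>v\<close> to \<open>u\<close>, the inner quotient
  moves \<open>u\<close> by at most \<open>d x y\<close>. The outer \<open>h\<close> sends
  \<open>u\<close> back to \<open>t\<close> and magnifies the displacement by at most
  \<open>3 ^ length h\<close>.\<close>

lemma conj_quotient_displacement:
  assumes \<phi>: "lipschitz_action d \<phi>" and h: "h \<in> carrier F" and xy: "x \<in> X" "y \<in> X"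
  shows "\<bar>foldr \<phi> (conj_quotient h x y) t - t\<bar> \<le> 3 ^ length h * d x y"
proof -
  define u where "u = foldr \<phi> (inv\<^bsub>F\<^esub> h) t"
  define v where "v = \<phi> (y, False) u"
  have "\<phi> (y, True) v = u"
    using lipschitz_actionD(1)[OF \<phi>, of "(y, True)" u] by (simp add: v_def inverse_letter_def)
  then have "\<bar>\<phi> (x, True) v - u\<bar> \<le> d x y"
    using lipschitz_actionD(3)[OF \<phi>, of x v y] by simp
  then have "3 ^ length h * \<bar>\<phi> (x, True) v - u\<bar> \<le> 3 ^ length h * d x y"
    by simp
  moreover have "foldr \<phi> (conj_quotient h x y) t = foldr \<phi> h (\<phi> (x, True) v)"
    using xy by (simp add: conj_quotient_def action_mult[OF \<phi>] free_generator_def inv_letter u_def v_def)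
  moreover have "foldr \<phi> h u = t"
    using action_inv[OF \<phi> h] by (simp add: u_def)
  ultimately show ?thesis
    using lipschitz_action_word[OF \<phi>, of h "\<phi> (x, True) v" u] by (simp only:)
qed

lemma small_product_displacement:
  assumes \<phi>: "lipschitz_action d \<phi>" and d: "\<And>x y. 0 \<le> d x y"
    and s: "\<And>n k x y. (x, y) \<in> s (prod_encode (n, k)) \<Longrightarrow> 3 ^ n * d x y \<le> (1/2) ^ Suc k"
    and "small_product s K g"
  shows "\<bar>foldr \<phi> g t - t\<bar> \<le> (\<Sum>k\<in>K. (1/2) ^ Suc k)"
  using assms(4)
proof (induction rule: small_product.induct)
  case one
  show ?case by (simp add: free_group_simps)
next
  case (mult K g k h n x y)
  have "\<bar>foldr \<phi> (conj_quotient h x y) (foldr \<phi> g t) - foldr \<phi> g t\<bar> \<le> 3 ^ length h * d x y"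
    using mult by (intro conj_quotient_displacement[OF \<phi>])
  also have "\<dots> \<le> 3 ^ n * d x y"
    using mult d by (intro mult_right_mono power_increasing) auto
  also have "\<dots> \<le> (1/2) ^ Suc k"
    using mult s by blast
  finally have "\<bar>foldr \<phi> (conj_quotient h x y \<otimes>\<^bsub>F\<^esub> g) t - t\<bar> \<le> (1/2) ^ Suc k + (\<Sum>k\<in>K. (1/2) ^ Suc k)"
    using mult.IH unfolding action_mult[OF \<phi>] by linarith
  also have "\<dots> = (\<Sum>k\<in>insert k K. (1/2) ^ Suc k)"
    using mult.hyps(2) small_product_finite[OF mult.hyps(1)] by simp
  finally show ?case .
qed

text \<open>The sequence \<open>s\<close> depends on \<open>d\<close> alone, so one neighbourhood
  serves all actions that are Lipschitz for \<open>d\<close>.\<close>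

lemma small_products_displacement:
  assumes d: "uniform_pseudometric d"
  obtains s where "\<And>i. s i \<in> \<U>"
    "\<And>\<phi> g t. \<lbrakk>lipschitz_action d \<phi>; g \<in> small_products s\<rbrakk> \<Longrightarrow> \<bar>foldr \<phi> g t - t\<bar> < 1"
proof -
  \<comment> \<open>The divisor \<open>3^n\<close> compensates the magnification by conjugating
    words of length at most \<open>n\<close>; the rest is the share of index \<open>k\<close> in a
    total below 1.\<close>
  have "\<exists>U\<in>\<U>. \<forall>(x, y)\<in>U. d x y < (1/2) ^ Suc (snd (prod_decode i)) / 3 ^ fst (prod_decode i)" for i
    by (rule uniform_pseudometric_small[OF d]) simp
  then obtain s where s: "\<And>i. s i \<in> \<U>"
    "\<And>i. \<forall>(x, y)\<in>s i. d x y < (1/2) ^ Suc (snd (prod_decode i)) / 3 ^ fst (prod_decode i)"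
    by metis
  have small: "3 ^ n * d x y \<le> (1/2) ^ Suc k" if "(x, y) \<in> s (prod_encode (n, k))" for n k x y
  proof -
    have "d x y < (1/2) ^ Suc k / 3 ^ n"
      using s(2)[of "prod_encode (n, k)"] that by auto
    then show ?thesis
      by (simp add: field_simps)
  qed
  show thesis
  proof
    fix \<phi> g t assume \<phi>: "lipschitz_action d \<phi>" and "g \<in> small_products s"
    then obtain K where K: "small_product s K g"
      by (auto simp: small_products_def)
    have "\<bar>foldr \<phi> g t - t\<bar> \<le> (\<Sum>k\<in>K. (1/2) ^ Suc k)"
      by (rule small_product_displacement[OF \<phi> uniform_pseudometricD(2)[OF d] small K])
    also have "\<dots> < 1"
      by (rule sum_half_powers_less_1[OF small_product_finite[OF K]])
    finally show "\<bar>foldr \<phi> g t - t\<bar> < 1" .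
  qed (fact s(1))
qed

lemma small_products_separate:
  assumes g: "g \<in> carrier F" "g \<noteq> \<one>\<^bsub>F\<^esub>"
  shows "\<exists>s. (\<forall>i. s i \<in> \<U>) \<and> g \<notin> small_products s"
proof -
  define Y where "Y = fst ` set g"
  have Y: "finite Y" "Y \<subseteq> X" and g': "reduced_word g" "g \<noteq> []"
    using g by (auto simp: Y_def free_group_simps)
  have "finite (Y \<times> Y - Id)"
    using Y(1) by blast
  then obtain V where V: "V \<in> \<U>" "V \<inter> (Y \<times> Y - Id) = {}"
    using entourage_avoiding[of "Y \<times> Y - Id"] Y(2) by blast
  obtain d where d: "uniform_pseudometric d"
    "\<And>n x y. \<lbrakk>x \<in> X; y \<in> X; d x y < (1/2)^n\<rbrakk> \<Longrightarrow> (x, y) \<in> V"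
    using exists_uniform_pseudometric[of "\<lambda>_. V"] V(1) by metis
  \<comment> \<open>Distinct generators in \<open>g\<close> have \<open>d\<close>-distance at least
    \<open>(1/2)^0 = 1\<close>; scaling by \<open>c\<close> raises this to the
    \<open>2 * length g\<close> required by \<open>separating_word\<close>.\<close>
  define c where "c = 2 * real (length g)"
  have "0 < c"
    using g' by (simp add: c_def)
  have d': "uniform_pseudometric (\<lambda>x y. c * d x y)"
    by (rule uniform_pseudometric_scale[OF d(1) \<open>0 < c\<close>])
  interpret separating_word "\<lambda>x y. c * d x y" g
  proof unfold_locales
    fix l m assume "l \<in> set g" "m \<in> set g" "fst l \<noteq> fst m"
    then have "(fst l, fst m) \<in> Y \<times> Y - Id" "fst l \<in> X" "fst m \<in> X"
      using Y(2) by (auto simp: Y_def)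
    then have "(fst l, fst m) \<notin> V"
      using V(2) by blast
    then have "\<not> d (fst l) (fst m) < (1/2) ^ 0"
      using d(2) \<open>fst l \<in> X\<close> \<open>fst m \<in> X\<close> by blast
    then show "real (2 * length g) \<le> c * d (fst l) (fst m)"
      using \<open>0 < c\<close> by (simp add: c_def)
  qed (fact g'(1) uniform_pseudometricD[OF d'])+
  obtain s where s: "\<And>i. s i \<in> \<U>"
    "\<And>\<phi> g t. \<lbrakk>lipschitz_action (\<lambda>x y. c * d x y) \<phi>; g \<in> small_products s\<rbrakk> \<Longrightarrow> \<bar>foldr \<phi> g t - t\<bar> < 1"
    using small_products_displacement[OF d'] by metis
  have "g \<notin> small_products s"
    using s(2)[OF lipschitz_letter_action, of g "length g"] letter_action_word g'(2) by (cases g) auto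
  then show ?thesis
    using s(1) by blast
qed

section \<open>The neighbourhood filter of the free topological group\<close>

abbreviation \<T> where "\<T> \<equiv> free_group_topology X \<U>"

text \<open>The quotient \<open>x y^-1\<close> has the trivial conjugating word, hence index (0, 0).
  The other one is \<open>x^-1 (y x^-1) x\<close>, with a conjugating word of length 1, hence index
  (1, 0).\<close>

lemma generator_quotients_in_small_products:
  assumes s': "\<forall>i. s i \<in> \<U>"
  shows "\<exists>U\<in>\<U>. \<forall>(x, y)\<in>U. inv\<^bsub>F\<^esub> free_generator x \<otimes>\<^bsub>F\<^esub> free_generator y \<in> small_products s \<and>
    free_generator x \<otimes>\<^bsub>F\<^esub> inv\<^bsub>F\<^esub> free_generator y \<in> small_products s"
proof -
  note s = spec[OF s']
  let ?U = "s (prod_encode (0, 0)) \<inter> s (prod_encode (1, 0))"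
  have "inv\<^bsub>F\<^esub> free_generator x \<otimes>\<^bsub>F\<^esub> free_generator y \<in> small_products s"
    "free_generator x \<otimes>\<^bsub>F\<^esub> inv\<^bsub>F\<^esub> free_generator y \<in> small_products s"
    if "(x, y) \<in> ?U" for x y
  proof -
    have xy: "x \<in> X" "y \<in> X"
      using that entourage_subset[OF s] by blast+
    have "small_product s {0} (conj_quotient \<one>\<^bsub>F\<^esub> x y)"
      using that xy by (intro small_product_single[where n = 0]) (simp_all add: free_group_simps reduced_word_def)
    then show "free_generator x \<otimes>\<^bsub>F\<^esub> inv\<^bsub>F\<^esub> free_generator y \<in> small_products s"
      using xy by (intro small_productsI) (simp add: conj_quotient_def)
    have "length (inv\<^bsub>F\<^esub> free_generator x) \<le> 1"
      using xy by (simp add: free_generator_def inv_letter)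
    then have "small_product s {0} (conj_quotient (inv\<^bsub>F\<^esub> free_generator x) y x)"
      using that xy entourage_symD[OF s] by (intro small_product_single[where n = 1]) auto
    then show "inv\<^bsub>F\<^esub> free_generator x \<otimes>\<^bsub>F\<^esub> free_generator y \<in> small_products s"
      using xy by (intro small_productsI) (simp add: conj_quotient_def m_assoc)
  qed
  then show ?thesis
    using entourage_Int[OF s s] by (intro bexI[of _ ?U]) auto
qed

text \<open>This candidate both witnesses that the free topology is itself a candidate and, being
  coarser than it, makes every set of small products open there.\<close>

lemma small_products_topology:
  obtains T where "free_group_topology_candidate X \<U> T"
    "\<And>s. \<forall>i. s i \<in> \<U> \<Longrightarrow> openin T (small_products s)"
proof -
  define \<B> where "\<B> = small_products ` {s. \<forall>i. s i \<in> \<U>}"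
  have \<B>I: "small_products s \<in> \<B>" if "\<forall>i. s i \<in> \<U>" for s
    using that by (auto simp: \<B>_def)
  have \<B>E: "\<exists>s. (\<forall>i. s i \<in> \<U>) \<and> B = small_products s" if "B \<in> \<B>" for B
    using that by (auto simp: \<B>_def)
  have "\<exists>T. topological_group_on F T \<and>
    (\<forall>W. openin T W \<longleftrightarrow> W \<subseteq> carrier F \<and> (\<forall>g\<in>W. \<exists>B\<in>\<B>. \<forall>b\<in>B. g \<otimes>\<^bsub>F\<^esub> b \<in> W))"
  proof (rule topological_group_of_base[of \<B>])
    show "\<B> \<noteq> {}"
      using \<B>I[of "\<lambda>_. X \<times> X"] entourage_full by blast
  next
    fix B assume "B \<in> \<B>"
    then show "B \<subseteq> carrier F" "\<one>\<^bsub>F\<^esub> \<in> B"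
      using \<B>E[of B] small_products_subset one_in_small_products by auto
  next
    fix A B assume A: "A \<in> \<B>" and B: "B \<in> \<B>"
    obtain s where s: "\<forall>i. s i \<in> \<U>" "A = small_products s"
      using \<B>E[OF A] by (elim exE conjE)
    obtain t where t: "\<forall>i. t i \<in> \<U>" "B = small_products t"
      using \<B>E[OF B] by (elim exE conjE)
    have "small_products (\<lambda>i. s i \<inter> t i) \<subseteq> A \<inter> B"
      unfolding s t by (intro Int_greatest small_products_mono) auto
    moreover have "small_products (\<lambda>i. s i \<inter> t i) \<in> \<B>"
      using s(1) t(1) by (intro \<B>I allI entourage_Int) auto
    ultimately show "\<exists>C\<in>\<B>. C \<subseteq> A \<inter> B"
      by blast
  next
    fix B assume B: "B \<in> \<B>"
    obtain s where s: "\<forall>i. s i \<in> \<U>" "B = small_products s"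
      using \<B>E[OF B] by (elim exE conjE)
    obtain t where t: "\<forall>i. t i \<in> \<U>"
      "\<forall>a\<in>small_products t. \<forall>b\<in>small_products t. a \<otimes>\<^bsub>F\<^esub> b \<in> small_products s"
      using small_products_mult[OF s(1)] by (elim exE conjE)
    show "\<exists>C\<in>\<B>. \<forall>a\<in>C. \<forall>b\<in>C. a \<otimes>\<^bsub>F\<^esub> b \<in> B"
      unfolding s(2) using t(2) \<B>I[OF t(1)] by (rule bexI)
  next
    fix B a assume B: "B \<in> \<B>" and a: "a \<in> B"
    obtain s where s: "\<forall>i. s i \<in> \<U>" "B = small_products s"
      using \<B>E[OF B] by (elim exE conjE)
    obtain K where K: "small_product s K a"
      using a unfolding s(2) small_products_def by blast
    show "inv\<^bsub>F\<^esub> a \<in> B"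
      unfolding s(2) by (rule small_productsI[OF small_product_inv[of s, OF entourage_sym[OF spec[OF s(1)]] K]])
    obtain t where t: "\<forall>i. t i \<in> \<U>" "\<forall>b\<in>small_products t. a \<otimes>\<^bsub>F\<^esub> b \<in> small_products s"
      using small_products_neighbourhood[OF s(1) small_productsI[OF K]] by (elim exE conjE)
    show "\<exists>C\<in>\<B>. \<forall>c\<in>C. a \<otimes>\<^bsub>F\<^esub> c \<in> B"
      unfolding s(2) using t(2) \<B>I[OF t(1)] by (rule bexI)
  next
    fix B g assume B: "B \<in> \<B>" and g: "g \<in> carrier F"
    obtain s where s: "\<forall>i. s i \<in> \<U>" "B = small_products s"
      using \<B>E[OF B] by (elim exE conjE)
    obtain t where t: "\<forall>i. t i \<in> \<U>"
      "\<forall>a\<in>small_products t. g \<otimes>\<^bsub>F\<^esub> a \<otimes>\<^bsub>F\<^esub> inv\<^bsub>F\<^esub> g \<in> small_products s"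
      using small_products_conj[OF s(1) g] by (elim exE conjE)
    show "\<exists>C\<in>\<B>. \<forall>c\<in>C. g \<otimes>\<^bsub>F\<^esub> c \<otimes>\<^bsub>F\<^esub> inv\<^bsub>F\<^esub> g \<in> B"
      unfolding s(2) using t(2) \<B>I[OF t(1)] by (rule bexI)
  next
    fix g assume "g \<in> carrier F" "g \<noteq> \<one>\<^bsub>F\<^esub>"
    from small_products_separate[OF this] show "\<exists>B\<in>\<B>. g \<notin> B"
      unfolding \<B>_def by blast
  qed
  then obtain T where T: "topological_group_on F T"
    "\<And>W. openin T W \<longleftrightarrow> W \<subseteq> carrier F \<and> (\<forall>g\<in>W. \<exists>B\<in>\<B>. \<forall>b\<in>B. g \<otimes>\<^bsub>F\<^esub> b \<in> W)"
    by blast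
  have op: "openin T (small_products s)" if s: "\<forall>i. s i \<in> \<U>" for s
    unfolding T(2)
  proof (intro conjI ballI small_products_subset)
    fix g assume "g \<in> small_products s"
    from small_products_neighbourhood[OF s this] show "\<exists>B\<in>\<B>. \<forall>b\<in>B. g \<otimes>\<^bsub>F\<^esub> b \<in> small_products s"
      using \<B>I by meson
  qed
  have "uniformly_continuous_between \<U> (two_sided_uniformity F T) free_generator"
    unfolding uniformly_continuous_between_def
  proof
    fix E assume "E \<in> two_sided_uniformity F T"
    then obtain V where V: "V \<in> identity_neighbourhoods F T"
      and E: "{(g, h) \<in> carrier F \<times> carrier F.
                inv\<^bsub>F\<^esub> g \<otimes>\<^bsub>F\<^esub> h \<in> V \<and> g \<otimes>\<^bsub>F\<^esub> inv\<^bsub>F\<^esub> h \<in> V} \<subseteq> E"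
      unfolding two_sided_uniformity_def by (elim CollectE conjE bexE)
    obtain W where W: "openin T W" "\<one>\<^bsub>F\<^esub> \<in> W" "W \<subseteq> V"
      using V unfolding identity_neighbourhoods_def by (elim CollectE conjE exE)
    have "\<exists>B\<in>\<B>. \<forall>b\<in>B. \<one>\<^bsub>F\<^esub> \<otimes>\<^bsub>F\<^esub> b \<in> W"
      using W(1,2) unfolding T(2) by simp
    then obtain B where B: "B \<in> \<B>" "\<forall>b\<in>B. \<one>\<^bsub>F\<^esub> \<otimes>\<^bsub>F\<^esub> b \<in> W"
      by (elim bexE)
    obtain s where s: "\<forall>i. s i \<in> \<U>" "B = small_products s"
      using \<B>E[OF B(1)] by (elim exE conjE)
    have BV: "b \<in> V" if "b \<in> small_products s" for b
      using that B(2) W(3) small_products_subset[of s] unfolding s(2) by (metis l_one subsetD)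
    obtain U where U: "U \<in> \<U>"
      "\<forall>(x, y)\<in>U. inv\<^bsub>F\<^esub> free_generator x \<otimes>\<^bsub>F\<^esub> free_generator y \<in> small_products s \<and>
        free_generator x \<otimes>\<^bsub>F\<^esub> inv\<^bsub>F\<^esub> free_generator y \<in> small_products s"
      using generator_quotients_in_small_products[OF s(1)] by (elim bexE)
    have "(free_generator x, free_generator y) \<in> E" if "(x, y) \<in> U" for x y
      using that U(2) BV entourage_subset[OF U(1)] by (intro subsetD[OF E]) auto
    then show "\<exists>U\<in>\<U>. \<forall>(x, y)\<in>U. (free_generator x, free_generator y) \<in> E"
      using U(1) by blast
  qed
  with T(1) op show thesis
    by (intro that) (auto simp: free_group_topology_candidate_def)
qed

lemma free_topology: "free_group_topology_candidate X \<U> \<T>"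
  by (rule small_products_topology) (rule free_group_topology_candidate[OF uniform])

lemma topological_group_free: "topological_group_on F \<T>"
  using free_topology by (simp add: free_group_topology_candidate_def)

lemma openin_small_products: "\<forall>i. s i \<in> \<U> \<Longrightarrow> openin \<T> (small_products s)"
  by (rule small_products_topology) (rule openin_free_group_topology)

end

section \<open>Identity neighbourhoods in topological groups\<close>

context
  fixes G :: "('g, 'm) monoid_scheme" (structure) and T :: "'g topology"
  assumes tg: "topological_group_on G T"
begin

interpretation group G
  using tg by (simp add: topological_group_on_def)

lemma topspace_topological_group: "topspace T = carrier G"
  using tg by (simp add: topological_group_on_def)

lemma continuous_map_mult:
  assumes "continuous_map Z T f" "continuous_map Z T g"
  shows "continuous_map Z T (\<lambda>x. f x \<otimes> g x)"
proof -
  have "continuous_map (prod_topology T T) T (\<lambda>(x, y). x \<otimes> y)"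
    using tg by (simp add: topological_group_on_def)
  from continuous_map_compose[OF continuous_map_pairedI[OF assms] this] show ?thesis
    by (simp add: o_def)
qed

lemma neighbourhood_preimage:
  assumes "continuous_map T T f" "f \<one> = \<one>" "openin T W" "\<one> \<in> W"
  shows "\<exists>V. openin T V \<and> \<one> \<in> V \<and> (\<forall>v\<in>V. f v \<in> W)"
  using openin_continuous_map_preimage[OF assms(1,3)] assms(2,4)
  by (intro exI[of _ "{x \<in> topspace T. f x \<in> W}"]) (auto simp: topspace_topological_group)

lemma neighbourhood_mult:
  assumes W: "openin T W" "\<one> \<in> W"
  shows "\<exists>V. openin T V \<and> \<one> \<in> V \<and> (\<forall>a\<in>V. \<forall>b\<in>V. a \<otimes> b \<in> W)"
proof -
  let ?S = "{z \<in> topspace (prod_topology T T). (case z of (x, y) \<Rightarrow> x \<otimes> y) \<in> W}"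
  have "continuous_map (prod_topology T T) T (\<lambda>(x, y). x \<otimes> y)"
    using tg by (simp add: topological_group_on_def)
  from openin_continuous_map_preimage[OF this W(1)] have S: "openin (prod_topology T T) ?S" .
  have "(\<one>, \<one>) \<in> ?S"
    using W(2) by (simp add: topspace_topological_group)
  with S obtain A B where AB: "openin T A" "openin T B" "\<one> \<in> A" "\<one> \<in> B" "A \<times> B \<subseteq> ?S"
    unfolding openin_prod_topology_alt by meson
  have "a \<otimes> b \<in> W" if "a \<in> A" "b \<in> B" for a b
    using subsetD[OF AB(5), of "(a, b)"] that by simp
  then show ?thesis
    using AB by (intro exI[of _ "A \<inter> B"]) auto
qed

lemma neighbourhood_mult3:
  assumes W: "openin T W" "\<one> \<in> W"
  shows "\<exists>V. openin T V \<and> \<one> \<in> V \<and> (\<forall>a\<in>V. \<forall>b\<in>V. \<forall>c\<in>V. a \<otimes> b \<otimes> c \<in> W)"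
proof -
  obtain A where A: "openin T A" "\<one> \<in> A" "\<forall>a\<in>A. \<forall>b\<in>A. a \<otimes> b \<in> W"
    using neighbourhood_mult[OF W] by (elim exE conjE)
  obtain B where B: "openin T B" "\<one> \<in> B" "\<forall>a\<in>B. \<forall>b\<in>B. a \<otimes> b \<in> A"
    using neighbourhood_mult[OF A(1,2)] by (elim exE conjE)
  show ?thesis
    using A B by (intro exI[of _ "A \<inter> B"]) auto
qed

lemma neighbourhood_inv:
  assumes "openin T W" "\<one> \<in> W"
  shows "\<exists>V. openin T V \<and> \<one> \<in> V \<and> (\<forall>v\<in>V. v \<in> W \<and> inv v \<in> W)"
proof -
  have "continuous_map T T (\<lambda>x. inv x)"
    using tg by (simp add: topological_group_on_def)
  from neighbourhood_preimage[OF this inv_one assms]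
  obtain V where "openin T V" "\<one> \<in> V" "\<forall>v\<in>V. inv v \<in> W"
    by (elim exE conjE)
  then show ?thesis
    using assms by (intro exI[of _ "V \<inter> W"]) auto
qed

lemma neighbourhood_conj:
  assumes "g \<in> carrier G" "openin T W" "\<one> \<in> W"
  shows "\<exists>V. openin T V \<and> \<one> \<in> V \<and> (\<forall>v\<in>V. g \<otimes> v \<otimes> inv g \<in> W)"
proof (rule neighbourhood_preimage[OF _ _ assms(2,3)])
  show "continuous_map T T (\<lambda>v. g \<otimes> v \<otimes> inv g)"
    using assms(1) by (intro continuous_map_mult) (simp_all add: topspace_topological_group continuous_map_id[unfolded id_def])
qed (use assms(1) in simp)

lemma neighbourhood_pow:
  assumes "openin T W" "\<one> \<in> W"
  shows "\<exists>V. openin T V \<and> \<one> \<in> V \<and> (\<forall>v\<in>V. v [^] (n::nat) \<in> W)"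
proof (rule neighbourhood_preimage[OF _ _ assms])
  show "continuous_map T T (\<lambda>v. v [^] n)"
  proof (induction n)
    case (Suc n)
    from continuous_map_mult[OF this continuous_map_id[unfolded id_def]] show ?case
      by simp
  qed (simp add: topspace_topological_group)
qed simp

end

section \<open>Tukey reductions\<close>

lemma Field_reverse_inclusion: "Field (reverse_inclusion \<A>) = \<A>"
  by (auto simp: reverse_inclusion_def Field_def)

text \<open>Reflexivity relates each such sequence to itself and so places it in the
  \<open>Field\<close>.\<close>

lemma Field_omega_power:
  assumes "\<And>p. p \<in> Field P \<Longrightarrow> (p, p) \<in> P"
  shows "Field (omega_power P) = {s. \<forall>n. s n \<in> Field P}"
proof -
  have "(s, s) \<in> omega_power P" if "\<forall>n. s n \<in> Field P" for s
    using that assms by (simp add: omega_power_def)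
  moreover have "\<forall>n. s n \<in> Field P" if "(s, t) \<in> omega_power P \<or> (t, s) \<in> omega_power P" for s t
    using that by (auto simp: omega_power_def Field_def)
  ultimately show ?thesis
    by (auto simp: Field_def[of "omega_power P"])
qed

text \<open>A point \<open>p\<close> lies below some \<open>f q\<close>; a cofinal set contains some
  \<open>c\<close> above \<open>q\<close>, and monotonicity puts \<open>f c\<close> above
  \<open>p\<close>. Both reductions below have this form.\<close>

lemma tukey_le_mono:
  assumes "\<And>q. q \<in> Field Q \<Longrightarrow> f q \<in> Field P"
    and mono: "\<And>q r. (q, r) \<in> Q \<Longrightarrow> (f q, f r) \<in> P"
    and cofinal: "\<And>p. p \<in> Field P \<Longrightarrow> \<exists>q\<in>Field Q. (p, f q) \<in> P"
    and trans: "trans P"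
  shows "P \<le>\<^sub>T Q"
  unfolding tukey_le_def
proof (intro exI conjI allI impI)
  show "f ` Field Q \<subseteq> Field P"
    using assms(1) by blast
  fix C assume C: "cofinal_subset Q C"
  show "cofinal_subset P (f ` C)"
    unfolding cofinal_subset_def
  proof (intro conjI ballI)
    show "f ` C \<subseteq> Field P"
      using assms(1) C by (auto simp: cofinal_subset_def)
    fix p assume "p \<in> Field P"
    then obtain q where q: "q \<in> Field Q" "(p, f q) \<in> P"
      using cofinal by blast
    then obtain c where c: "c \<in> C" "(q, c) \<in> Q"
      using C by (auto simp: cofinal_subset_def)
    then have "(p, f c) \<in> P"
      using q mono trans by (meson transD)
    then show "\<exists>c\<in>f ` C. (p, c) \<in> P"
      using c by blast
  qed
qed

text \<open>If \<open>S\<close> were unbounded, well-ordering of cardinals would provide an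
  unbounded set of least cardinality, so the \<open>SOME\<close> in \<open>add_card\<close> would
  denote one, of cardinality at most that of \<open>S\<close>.\<close>

lemma bounded_of_less_add_card:
  assumes "\<not> has_largest P" "|S| <o add_card P" "S \<subseteq> Field P"
  shows "\<exists>u\<in>Field P. \<forall>s\<in>S. (s, u) \<in> P"
proof (rule ccontr)
  assume "\<not> ?thesis"
  then have S: "unbounded_subset P S"
    using assms(3) by (simp add: unbounded_subset_def)
  then have "\<exists>r\<in>{|S| | S. unbounded_subset P S}. \<forall>r'\<in>{|S| | S. unbounded_subset P S}. r \<le>o r'"
    by (intro exists_minim_Card_order) (auto simp: card_of_Card_order)
  then have "\<exists>M. unbounded_subset P M \<and> (\<forall>S'. unbounded_subset P S' \<longrightarrow> |M| \<le>o |S'| )"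
    by blast
  from someI_ex[OF this] have "add_card P \<le>o |S|"
    using assms(1) S by (simp add: add_card_def)
  then show False
    using assms(2) not_ordLess_ordLeq by blast
qed

section \<open>Precompactness and conjugates of quotients of generators\<close>

context uniform_space_carrier
begin

lemma add_card_entourages:
  assumes nondiscrete: "\<not> discrete_uniformity X \<U>"
    and A: "|A| <o add_card (reverse_inclusion \<U>)" and V: "\<And>a. a \<in> A \<Longrightarrow> V a \<in> \<U>"
  shows "\<exists>U\<in>\<U>. \<forall>a\<in>A. U \<subseteq> V a"
proof -
  \<comment> \<open>A least entourage would be the intersection of all, which is the
    diagonal.\<close>
  have "\<not> has_largest (reverse_inclusion \<U>)"
  proof
    assume "has_largest (reverse_inclusion \<U>)"
    then obtain M where M: "M \<in> \<U>" "\<forall>V\<in>\<U>. M \<subseteq> V"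
      by (auto simp: has_largest_def Field_reverse_inclusion) (auto simp: reverse_inclusion_def)
    then have "M \<subseteq> Id_on X"
      unfolding Inter_entourages[symmetric] by (intro Inter_greatest) simp
    moreover have "Id_on X \<subseteq> M"
      using entourage_refl[OF M(1)] by auto
    ultimately show False
      using nondiscrete M(1) by (simp add: discrete_uniformity_def)
  qed
  moreover have "|V ` A| <o add_card (reverse_inclusion \<U>)"
    using card_of_image A by (rule ordLeq_ordLess_trans)
  ultimately have "\<exists>U\<in>\<U>. \<forall>W\<in>V ` A. (W, U) \<in> reverse_inclusion \<U>"
    using bounded_of_less_add_card[of "reverse_inclusion \<U>" "V ` A"] V
    by (simp add: Field_reverse_inclusion image_subset_iff)
  then show ?thesis
    by (auto simp: reverse_inclusion_def)
qed

text \<open>In the induction step, \<open>h = z h'\<close> is rewritten as \<open>w (a h')\<close>,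
  where \<open>a\<close> is a chosen letter near \<open>z\<close> and \<open>w = z a^-1\<close> is
  small. Conjugation by \<open>a\<close> is handled separately for each \<open>a\<close>, and
  conjugation by \<open>w\<close> by the triple product.\<close>

lemma neighbourhood_conj_quotients:
  assumes nondiscrete: "\<not> discrete_uniformity X \<U>"
    and precompact: "precompact_below (add_card (reverse_inclusion \<U>)) X \<U>"
    and "openin \<T> W" "\<one>\<^bsub>F\<^esub> \<in> W"
  shows "\<exists>U\<in>\<U>. \<forall>h\<in>carrier F. length h \<le> n \<longrightarrow> (\<forall>x y. (x, y) \<in> U \<longrightarrow> conj_quotient h x y \<in> W)"
  using assms(3,4)
proof (induction n arbitrary: W)
  case 0
  obtain U where U: "U \<in> \<U>" "\<forall>x y. (x, y) \<in> U \<longrightarrow>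
      inv\<^bsub>F\<^esub> free_generator x \<otimes>\<^bsub>F\<^esub> free_generator y \<in> W \<and>
      free_generator x \<otimes>\<^bsub>F\<^esub> inv\<^bsub>F\<^esub> free_generator y \<in> W"
    using candidate_entourage[OF free_topology 0] by (elim bexE)
  have "conj_quotient h x y \<in> W" if "h \<in> carrier F" "length h \<le> 0" "(x, y) \<in> U" for h x y
  proof -
    have "h = \<one>\<^bsub>F\<^esub>" "x \<in> X" "y \<in> X"
      using that entourage_subset[OF U(1)] by (auto simp: free_group_simps)
    then show ?thesis
      using U(2) that(3) by (simp add: conj_quotient_def)
  qed
  then show ?case
    using U(1) by blast
next
  case (Suc n)
  note tg = topological_group_free
  obtain V where V: "openin \<T> V" "\<one>\<^bsub>F\<^esub> \<in> V" "\<forall>a\<in>V. \<forall>b\<in>V. \<forall>c\<in>V. a \<otimes>\<^bsub>F\<^esub> b \<otimes>\<^bsub>F\<^esub> c \<in> W"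
    using neighbourhood_mult3[OF tg Suc.prems] by (elim exE conjE)
  obtain V' where V': "openin \<T> V'" "\<one>\<^bsub>F\<^esub> \<in> V'" "\<forall>v\<in>V'. v \<in> V \<and> inv\<^bsub>F\<^esub> v \<in> V"
    using neighbourhood_inv[OF tg V(1,2)] by (elim exE conjE)
  obtain E where E: "E \<in> \<U>" "\<forall>x y. (x, y) \<in> E \<longrightarrow>
      inv\<^bsub>F\<^esub> free_generator x \<otimes>\<^bsub>F\<^esub> free_generator y \<in> V' \<and>
      free_generator x \<otimes>\<^bsub>F\<^esub> inv\<^bsub>F\<^esub> free_generator y \<in> V'"
    using candidate_entourage[OF free_topology V'(1,2)] by (elim bexE)
  obtain A where A: "A \<subseteq> X" "|A| <o add_card (reverse_inclusion \<U>)"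
    "X = (\<Union>a\<in>A. entourage_ball X a E)"
    using precompact E(1) unfolding precompact_below_def by meson
  define P where "P a b U \<longleftrightarrow> U \<in> \<U> \<and> (\<forall>h\<in>carrier F. length h \<le> n \<longrightarrow> (\<forall>x y. (x, y) \<in> U \<longrightarrow>
      [(a, b)] \<otimes>\<^bsub>F\<^esub> conj_quotient h x y \<otimes>\<^bsub>F\<^esub> inv\<^bsub>F\<^esub> [(a, b)] \<in> V))" for a b U
  \<comment> \<open>The induction hypothesis is applied to a neighbourhood that conjugation by the
    letter \<open>(a, b)\<close> carries into \<open>V\<close>.\<close>
  have ex: "\<exists>U. P a b U" if "a \<in> A" for a b
  proof -
    have "[(a, b)] \<in> carrier F"
      using that A(1) by (intro letter_in_free_group) auto
    from neighbourhood_conj[OF tg this V(1,2)] obtain Wa where Wa: "openin \<T> Wa" "\<one>\<^bsub>F\<^esub> \<in> Wa"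
      "\<forall>v\<in>Wa. [(a, b)] \<otimes>\<^bsub>F\<^esub> v \<otimes>\<^bsub>F\<^esub> inv\<^bsub>F\<^esub> [(a, b)] \<in> V"
      by (elim exE conjE)
    obtain U where "U \<in> \<U>" "\<forall>h\<in>carrier F. length h \<le> n \<longrightarrow> (\<forall>x y. (x, y) \<in> U \<longrightarrow> conj_quotient h x y \<in> Wa)"
      using Suc.IH[OF Wa(1,2)] by (elim bexE)
    then have "P a b U"
      using Wa(3) by (simp add: P_def)
    then show ?thesis ..
  qed
  define Q where "Q a b = (SOME U. P a b U)" for a b
  have "P a b (Q a b)" if "a \<in> A" for a b
    unfolding Q_def by (rule someI_ex[OF ex[OF that]])
  then have Q: "\<And>a b. a \<in> A \<Longrightarrow> Q a b \<in> \<U>"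
    "\<And>a b h x y. \<lbrakk>a \<in> A; h \<in> carrier F; length h \<le> n; (x, y) \<in> Q a b\<rbrakk> \<Longrightarrow>
      [(a, b)] \<otimes>\<^bsub>F\<^esub> conj_quotient h x y \<otimes>\<^bsub>F\<^esub> inv\<^bsub>F\<^esub> [(a, b)] \<in> V"
    unfolding P_def by simp_all
  \<comment> \<open>Intersecting over the two signs first keeps the family indexed by
    \<open>A\<close>, whose cardinality is below \<open>add_card\<close>.\<close>
  have "\<exists>U\<in>\<U>. \<forall>a\<in>A. U \<subseteq> Q a True \<inter> Q a False"
    by (rule add_card_entourages[OF nondiscrete A(2)]) (intro entourage_Int Q(1))
  then obtain U where U: "U \<in> \<U>" "\<forall>a\<in>A. U \<subseteq> Q a True \<inter> Q a False"
    by (elim bexE)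
  \<comment> \<open>The empty word has no first letter to replace; \<open>U'\<close> covers
    it.\<close>
  obtain U' where U': "U' \<in> \<U>"
    "\<forall>h\<in>carrier F. length h \<le> n \<longrightarrow> (\<forall>x y. (x, y) \<in> U' \<longrightarrow> conj_quotient h x y \<in> W)"
    using Suc.IH[OF Suc.prems] by (elim bexE)
  have "conj_quotient h x y \<in> W"
    if h: "h \<in> carrier F" "length h \<le> Suc n" and xy: "(x, y) \<in> U \<inter> U'" for h x y
  proof (cases h)
    case Nil
    then show ?thesis
      using U'(2) h(1) xy by auto
  next
    case (Cons l h')
    obtain z b where l: "l = (z, b)"
      by (cases l)
    have z: "z \<in> X" and h': "h' \<in> carrier F" "length h' \<le> n"
      using h Cons l by (auto simp: free_group_simps reduced_word_def successively_Cons)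
    have hh': "h = [(z, b)] \<otimes>\<^bsub>F\<^esub> h'"
      using h(1) Cons l by (cases h') (auto simp: free_group_simps reduced_word_def)
    have xyX: "x \<in> X" "y \<in> X"
      using xy entourage_subset[OF U(1)] by auto
    obtain a where a: "a \<in> A" "(a, z) \<in> E"
      using z A(3) by (auto simp: entourage_ball_def)
    then have aX: "a \<in> X" and za: "(z, a) \<in> E"
      using A(1) entourage_symD[OF E(1)] by auto
    note letters = letter_in_free_group[OF z, of b] letter_in_free_group[OF aX, of b]
    define w where "w = [(z, b)] \<otimes>\<^bsub>F\<^esub> inv\<^bsub>F\<^esub> [(a, b)]"
    have w: "w \<in> carrier F"
      using letters by (simp add: w_def)
    \<comment> \<open>For an inverse letter, \<open>w\<close> is \<open>z^-1 a\<close>; this is why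
      \<open>E\<close> controls both one-sided quotients.\<close>
    have "w \<in> V'"
      using E(2)[rule_format, OF za] inv_letter[OF z, of True] inv_letter[OF aX, of True] inv_letter[OF aX, of False]
      by (cases b) (simp_all add: w_def free_generator_def)
    then have wV: "w \<in> V" "inv\<^bsub>F\<^esub> w \<in> V"
      using V'(3) by auto
    have "(x, y) \<in> Q a b"
      using U(2) a(1) xy by (cases b) auto
    then have mid: "[(a, b)] \<otimes>\<^bsub>F\<^esub> conj_quotient h' x y \<otimes>\<^bsub>F\<^esub> inv\<^bsub>F\<^esub> [(a, b)] \<in> V"
      by (rule Q(2)[OF a(1) h'])
    have "inv\<^bsub>F\<^esub> [(a, b)] \<otimes>\<^bsub>F\<^esub> ([(a, b)] \<otimes>\<^bsub>F\<^esub> h') = h'"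
      using letters h'(1) by (simp flip: m_assoc)
    then have "h = w \<otimes>\<^bsub>F\<^esub> ([(a, b)] \<otimes>\<^bsub>F\<^esub> h')"
      using letters h'(1) unfolding hh' w_def by (simp add: m_assoc)
    then have "conj_quotient h x y =
        w \<otimes>\<^bsub>F\<^esub> ([(a, b)] \<otimes>\<^bsub>F\<^esub> conj_quotient h' x y \<otimes>\<^bsub>F\<^esub> inv\<^bsub>F\<^esub> [(a, b)]) \<otimes>\<^bsub>F\<^esub> inv\<^bsub>F\<^esub> w"
      using letters w h'(1) xyX by (simp add: conj_conj_quotient)
    then show ?thesis
      using V(3) wV mid by simp
  qed
  then show ?case
    using entourage_Int[OF U(1) U'(1)] by blast
qed

text \<open>The factors occur in arbitrary order of their indices, so they cannot simply be absorbed
  one after another. Instead, removing the factor of index \<open>k\<close> is a link of weight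
  \<open>(1/2)^Suc k\<close> in a chain from \<open>g\<close> to the identity, and
  \<open>weighted_chain_less\<close> applies.\<close>

lemma small_products_cofinal:
  assumes nondiscrete: "\<not> discrete_uniformity X \<U>"
    and precompact: "precompact_below (add_card (reverse_inclusion \<U>)) X \<U>"
    and N: "N \<in> identity_neighbourhoods F \<T>"
  shows "\<exists>s. (\<forall>i. s i \<in> \<U>) \<and> small_products s \<subseteq> N"
proof -
  obtain W0 where W0: "openin \<T> W0" "\<one>\<^bsub>F\<^esub> \<in> W0" "W0 \<subseteq> N"
    using N unfolding identity_neighbourhoods_def by (elim CollectE conjE exE)
  \<comment> \<open>The clause for \<open>k = 0\<close> pins the first term of the sequence to
    \<open>W0\<close> during dependent choice.\<close>
  have "\<exists>W. \<forall>k. (openin \<T> (W k) \<and> \<one>\<^bsub>F\<^esub> \<in> W k \<and> (k = 0 \<longrightarrow> W k = W0)) \<and>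
      (\<forall>a\<in>W (Suc k). \<forall>b\<in>W (Suc k). \<forall>c\<in>W (Suc k). a \<otimes>\<^bsub>F\<^esub> b \<otimes>\<^bsub>F\<^esub> c \<in> W k)"
  proof (rule dependent_nat_choice)
    show "\<exists>W. openin \<T> W \<and> \<one>\<^bsub>F\<^esub> \<in> W \<and> (0 = (0::nat) \<longrightarrow> W = W0)"
      using W0 by blast
  next
    fix W and k :: nat
    assume "openin \<T> W \<and> \<one>\<^bsub>F\<^esub> \<in> W \<and> (k = 0 \<longrightarrow> W = W0)"
    then show "\<exists>V. (openin \<T> V \<and> \<one>\<^bsub>F\<^esub> \<in> V \<and> (Suc k = 0 \<longrightarrow> V = W0)) \<and>
        (\<forall>a\<in>V. \<forall>b\<in>V. \<forall>c\<in>V. a \<otimes>\<^bsub>F\<^esub> b \<otimes>\<^bsub>F\<^esub> c \<in> W)"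
      using neighbourhood_mult3[OF topological_group_free, of W] by simp
  qed
  then obtain W where W: "\<And>k. openin \<T> (W k)" "\<And>k. \<one>\<^bsub>F\<^esub> \<in> W k" "W 0 = W0"
    "\<And>k a b c. \<lbrakk>a \<in> W (Suc k); b \<in> W (Suc k); c \<in> W (Suc k)\<rbrakk> \<Longrightarrow> a \<otimes>\<^bsub>F\<^esub> b \<otimes>\<^bsub>F\<^esub> c \<in> W k"
    by metis
  \<comment> \<open>Index \<open>k\<close> gets \<open>W (Suc k)\<close> rather than
    \<open>W k\<close>, so that the total weight over distinct indices stays below 1, the bound
    belonging to \<open>R 0\<close>.\<close>
  have "\<exists>U\<in>\<U>. \<forall>h\<in>carrier F. length h \<le> fst (prod_decode i) \<longrightarrow>
      (\<forall>x y. (x, y) \<in> U \<longrightarrow> conj_quotient h x y \<in> W (Suc (snd (prod_decode i))))" for i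
    by (rule neighbourhood_conj_quotients[OF nondiscrete precompact W(1,2)])
  then obtain s where s: "\<And>i. s i \<in> \<U>"
    "\<And>i h x y. \<lbrakk>h \<in> carrier F; length h \<le> fst (prod_decode i); (x, y) \<in> s i\<rbrakk> \<Longrightarrow>
      conj_quotient h x y \<in> W (Suc (snd (prod_decode i)))"
    by metis
  \<comment> \<open>\<open>Id\<close> covers the words outside the carrier, since reflexivity is
    required on the whole type.\<close>
  define R where "R k = {(a, b). a \<in> carrier F \<and> b \<in> carrier F \<and> a \<otimes>\<^bsub>F\<^esub> inv\<^bsub>F\<^esub> b \<in> W k} \<union> Id" for k
  have WSuc: "a \<in> W k" if "a \<in> W (Suc k)" "a \<in> carrier F" for a k
    using W(4)[OF that(1) W(2) W(2)] that(2) by simp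
  have W2: "a \<otimes>\<^bsub>F\<^esub> b \<in> W k" if "a \<in> W (Suc k)" "b \<in> W (Suc k)" "a \<in> carrier F" "b \<in> carrier F" for a b k
    using W(4)[OF that(1,2) W(2)] that(3,4) by simp
  have inv_cancel: "inv\<^bsub>F\<^esub> a \<otimes>\<^bsub>F\<^esub> (a \<otimes>\<^bsub>F\<^esub> b) = b" if "a \<in> carrier F" "b \<in> carrier F" for a b
    using that by (simp flip: m_assoc)
  have cancel: "a \<otimes>\<^bsub>F\<^esub> inv\<^bsub>F\<^esub> b \<otimes>\<^bsub>F\<^esub> (b \<otimes>\<^bsub>F\<^esub> inv\<^bsub>F\<^esub> c) = a \<otimes>\<^bsub>F\<^esub> inv\<^bsub>F\<^esub> c"
    if "a \<in> carrier F" "b \<in> carrier F" "c \<in> carrier F" for a b c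
    using that by (simp add: m_assoc inv_cancel)
  have cube: "R (Suc k) O R (Suc k) O R (Suc k) \<subseteq> R k" for k
  proof -
    have one: "(a, b) \<in> R k" if "(a, b) \<in> R (Suc k)" for a b
      using that WSuc[of "a \<otimes>\<^bsub>F\<^esub> inv\<^bsub>F\<^esub> b" k] by (auto simp: R_def)
    have R: "a \<in> carrier F \<and> b \<in> carrier F \<and> a \<otimes>\<^bsub>F\<^esub> inv\<^bsub>F\<^esub> b \<in> W j" if "(a, b) \<in> R j" "a \<noteq> b" for a b j
      using that by (simp add: R_def)
    have RI: "(a, b) \<in> R j" if "a \<in> carrier F" "b \<in> carrier F" "a \<otimes>\<^bsub>F\<^esub> inv\<^bsub>F\<^esub> b \<in> W j" for a b j
      using that by (simp add: R_def)
    have two: "(a, c) \<in> R k" if "(a, b) \<in> R (Suc k)" "(b, c) \<in> R (Suc k)" "a \<noteq> b" "b \<noteq> c" for a b c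
    proof -
      note ab = R[OF that(1,3)] and bc = R[OF that(2,4)]
      have "a \<otimes>\<^bsub>F\<^esub> inv\<^bsub>F\<^esub> b \<otimes>\<^bsub>F\<^esub> (b \<otimes>\<^bsub>F\<^esub> inv\<^bsub>F\<^esub> c) \<in> W k"
        using ab bc W2[of "a \<otimes>\<^bsub>F\<^esub> inv\<^bsub>F\<^esub> b" k "b \<otimes>\<^bsub>F\<^esub> inv\<^bsub>F\<^esub> c"] by simp
      then show ?thesis
        using ab bc by (simp add: RI cancel)
    qed
    have three: "(a, e) \<in> R k"
      if "(a, b) \<in> R (Suc k)" "(b, c) \<in> R (Suc k)" "(c, e) \<in> R (Suc k)" "a \<noteq> b" "b \<noteq> c" "c \<noteq> e" for a b c e
    proof -
      note ab = R[OF that(1,4)] and bc = R[OF that(2,5)] and ce = R[OF that(3,6)]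
      have "a \<otimes>\<^bsub>F\<^esub> inv\<^bsub>F\<^esub> b \<otimes>\<^bsub>F\<^esub> (b \<otimes>\<^bsub>F\<^esub> inv\<^bsub>F\<^esub> c) \<otimes>\<^bsub>F\<^esub> (c \<otimes>\<^bsub>F\<^esub> inv\<^bsub>F\<^esub> e) \<in> W k"
        using ab bc ce W(4)[of "a \<otimes>\<^bsub>F\<^esub> inv\<^bsub>F\<^esub> b" k "b \<otimes>\<^bsub>F\<^esub> inv\<^bsub>F\<^esub> c" "c \<otimes>\<^bsub>F\<^esub> inv\<^bsub>F\<^esub> e"] by simp
      then show ?thesis
        using ab bc ce by (simp add: RI cancel)
    qed
    show ?thesis
    proof clarify
      fix a b c e assume "(a, b) \<in> R (Suc k)" "(b, c) \<in> R (Suc k)" "(c, e) \<in> R (Suc k)"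
      then show "(a, e) \<in> R k"
        using one two three by (cases "a = b"; cases "b = c"; cases "c = e") blast+
    qed
  qed
  have chain: "\<exists>n. weighted_chain R n g \<one>\<^bsub>F\<^esub> (\<Sum>k\<in>K. (1/2) ^ Suc k)" if "small_product s K g" for K g
    using that
  proof (induction rule: small_product.induct)
    case one
    then show ?case
      using weighted_chain.refl[of R "\<one>\<^bsub>F\<^esub>"] by auto
  next
    case (mult K g k h n x y)
    have "conj_quotient h x y \<in> W (Suc k)"
      using s(2)[of h "prod_encode (n, k)" x y] mult.hyps by simp
    moreover have "conj_quotient h x y \<otimes>\<^bsub>F\<^esub> g \<otimes>\<^bsub>F\<^esub> inv\<^bsub>F\<^esub> g = conj_quotient h x y"
      using mult.hyps small_product_closed by (simp add: m_assoc)
    ultimately have "(conj_quotient h x y \<otimes>\<^bsub>F\<^esub> g, g) \<in> R (Suc k)"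
      using mult.hyps small_product_closed by (simp add: R_def)
    moreover have "(\<Sum>k\<in>insert k K. (1/2::real) ^ Suc k) = (1/2) ^ Suc k + (\<Sum>k\<in>K. (1/2) ^ Suc k)"
      using mult.hyps(2) small_product_finite[OF mult.hyps(1)] by simp
    ultimately show ?case
      using mult.IH weighted_chain.step[of "conj_quotient h x y \<otimes>\<^bsub>F\<^esub> g" g R "Suc k"] by (simp only:) blast
  qed
  have "g \<in> W0" if g: "g \<in> small_products s" for g
  proof -
    obtain K where K: "small_product s K g"
      using g by (auto simp: small_products_def)
    then obtain n where "weighted_chain R n g \<one>\<^bsub>F\<^esub> (\<Sum>k\<in>K. (1/2) ^ Suc k)"
      using chain by blast
    moreover have "(\<Sum>k\<in>K. (1/2::real) ^ Suc k) < (1/2) ^ 0"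
      using sum_half_powers_less_1[OF small_product_finite[OF K]] by simp
    moreover have "\<And>k. Id \<subseteq> R k"
      by (auto simp: R_def)
    ultimately have "(g, \<one>\<^bsub>F\<^esub>) \<in> R 0"
      by (rule weighted_chain_less[of R, OF _ cube, rotated])
    then show ?thesis
      using W(2)[of 0] W(3) by (auto simp: R_def)
  qed
  then show ?thesis
    using s(1) W0(3) by blast
qed

section \<open>Powers of quotients of generators\<close>

definition power_entourage :: "('a \<times> bool) list set \<Rightarrow> nat \<Rightarrow> 'a rel" where
  "power_entourage W m = {(x, y) \<in> X \<times> X.
     (free_generator x \<otimes>\<^bsub>F\<^esub> inv\<^bsub>F\<^esub> free_generator y) [^]\<^bsub>F\<^esub> m \<in> W \<and>
     (free_generator y \<otimes>\<^bsub>F\<^esub> inv\<^bsub>F\<^esub> free_generator x) [^]\<^bsub>F\<^esub> m \<in> W}"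

lemma power_entourage:
  assumes "N \<in> identity_neighbourhoods F \<T>"
  shows "power_entourage N m \<in> \<U>"
proof -
  obtain W where W: "openin \<T> W" "\<one>\<^bsub>F\<^esub> \<in> W" "W \<subseteq> N"
    using assms unfolding identity_neighbourhoods_def by (elim CollectE conjE exE)
  obtain V where V: "openin \<T> V" "\<one>\<^bsub>F\<^esub> \<in> V" "\<forall>v\<in>V. v [^]\<^bsub>F\<^esub> m \<in> W"
    using neighbourhood_pow[OF topological_group_free W(1,2)] by blast
  obtain U where U: "U \<in> \<U>" "\<forall>x y. (x, y) \<in> U \<longrightarrow>
      inv\<^bsub>F\<^esub> free_generator x \<otimes>\<^bsub>F\<^esub> free_generator y \<in> V \<and>
      free_generator x \<otimes>\<^bsub>F\<^esub> inv\<^bsub>F\<^esub> free_generator y \<in> V"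
    using candidate_entourage[OF free_topology V(1,2)] by (elim bexE)
  show ?thesis
  proof (rule entourage_mono[OF U(1)])
    show "U \<subseteq> power_entourage N m"
    proof
      fix p assume p: "p \<in> U"
      obtain x y where xy: "p = (x, y)"
        by (cases p)
      have "(x, y) \<in> U" "(y, x) \<in> U" "x \<in> X" "y \<in> X"
        using p xy entourage_symD[OF U(1)] entourage_subset[OF U(1)] by auto
      then show "p \<in> power_entourage N m"
        using U(2) V(3) W(3) xy by (auto simp: power_entourage_def)
    qed
    \<comment> \<open>The second condition in \<open>power_entourage\<close> serves this purpose, as
      \<open>N\<close> need not be closed under inversion.\<close>
    show "sym (power_entourage N m)"
      by (auto simp: power_entourage_def sym_def)
  qed (auto simp: power_entourage_def)
qed

text \<open>The generator \<open>z\<close> acts trivially, so the quotient translates by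
  \<open>d x z\<close> and its powers multiply this. A fixed displacement bound thereby yields
  arbitrarily fine bounds on \<open>d\<close>.\<close>

lemma translation_action_pow:
  assumes d: "uniform_pseudometric d" and xz: "x \<in> X" "z \<in> X"
  defines "\<phi> \<equiv> \<lambda>l t. if snd l then t + d (fst l) z else t - d (fst l) z"
  shows "lipschitz_action d \<phi>"
    and "foldr \<phi> ((free_generator x \<otimes>\<^bsub>F\<^esub> inv\<^bsub>F\<^esub> free_generator z) [^]\<^bsub>F\<^esub> (m::nat)) t = t + m * d x z"
proof -
  have "\<bar>d a z - d b z\<bar> \<le> d a b" for a b
    using uniform_pseudometricD(4)[OF d, of a z b] uniform_pseudometricD(4)[OF d, of b z a]
      uniform_pseudometricD(3)[OF d, of a b] by linarith
  then show \<phi>: "lipschitz_action d \<phi>"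
    by (auto simp: lipschitz_action_def \<phi>_def inverse_letter_def)
  let ?q = "free_generator x \<otimes>\<^bsub>F\<^esub> inv\<^bsub>F\<^esub> free_generator z"
  have q: "foldr \<phi> ?q t = t + d x z" for t
    using xz uniform_pseudometricD(1)[OF d]
    by (simp add: action_mult[OF \<phi>] free_generator_def inv_letter) (simp add: \<phi>_def)
  have "foldr \<phi> (g [^]\<^bsub>F\<^esub> m) t = t + m * c" if "\<And>t. foldr \<phi> g t = t + c" for g t and c :: real
    using that by (induction m arbitrary: t)
      (simp_all add: action_mult[OF \<phi>] free_group_simps(3) distrib_right)
  from this[of ?q, OF q] show "foldr \<phi> (?q [^]\<^bsub>F\<^esub> (m::nat)) t = t + m * d x z" .
qed

text \<open>The action used depends on \<open>y\<close>, but \<open>s\<close> does not. Displacement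
  below 1 by the power \<open>2 ^ n\<close> reads \<open>2 ^ n * d x y < 1\<close>, which is the
  condition for membership in \<open>t n\<close>.\<close>

lemma neighbourhood_with_small_power_entourages:
  assumes t: "\<forall>n. t n \<in> \<U>"
  shows "\<exists>N\<in>identity_neighbourhoods F \<T>. \<forall>n. power_entourage N (2 ^ n) \<subseteq> t n"
proof -
  obtain d where d: "uniform_pseudometric d"
    "\<And>n x y. \<lbrakk>x \<in> X; y \<in> X; d x y < (1/2)^n\<rbrakk> \<Longrightarrow> (x, y) \<in> t n"
    using exists_uniform_pseudometric[of t, OF spec[OF t]] by metis
  obtain s where s: "\<And>i. s i \<in> \<U>"
    "\<And>\<phi> g u. \<lbrakk>lipschitz_action d \<phi>; g \<in> small_products s\<rbrakk> \<Longrightarrow> \<bar>foldr \<phi> g u - u\<bar> < 1"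
    using small_products_displacement[OF d(1)] by metis
  have "small_products s \<in> identity_neighbourhoods F \<T>"
    using openin_small_products[of s] s(1) one_in_small_products small_products_subset
    by (auto simp: identity_neighbourhoods_def)
  moreover have "(x, y) \<in> t n" if "(x, y) \<in> power_entourage (small_products s) (2 ^ n)" for n x y
  proof -
    have xy: "x \<in> X" "y \<in> X"
      "(free_generator x \<otimes>\<^bsub>F\<^esub> inv\<^bsub>F\<^esub> free_generator y) [^]\<^bsub>F\<^esub> ((2::nat) ^ n) \<in> small_products s"
      using that by (auto simp: power_entourage_def)
    have "\<bar>0 + real (2 ^ n) * d x y - 0\<bar> < 1"
      using s(2)[OF translation_action_pow(1)[OF d(1) xy(1,2)] xy(3), of 0]
      unfolding translation_action_pow(2)[OF d(1) xy(1,2)] .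
    then have "d x y < (1/2) ^ n"
      using uniform_pseudometricD(2)[OF d(1), of x y] by (simp add: field_simps)
    then show ?thesis
      by (rule d(2)[OF xy(1,2)])
  qed
  ultimately show ?thesis
    by (meson subrelI)
qed

end

section \<open>The order on sequences of entourages and the Tukey equivalence\<close>

lemma Field_entourage_sequences: "Field (omega_power (reverse_inclusion \<U>)) = {s. \<forall>n. s n \<in> \<U>}"
proof -
  have "(V, V) \<in> reverse_inclusion \<U>" if "V \<in> Field (reverse_inclusion \<U>)" for V
    using that unfolding Field_reverse_inclusion by (simp add: reverse_inclusion_def)
  from Field_omega_power[OF this] show ?thesis
    by (simp add: Field_reverse_inclusion)
qed

lemma in_omega_power_reverse_inclusion:
  "(s, t) \<in> omega_power (reverse_inclusion \<U>) \<longleftrightarrow> (\<forall>n. s n \<in> \<U> \<and> t n \<in> \<U> \<and> t n \<subseteq> s n)"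
  by (auto simp: omega_power_def reverse_inclusion_def)

lemma trans_reverse_inclusion: "trans (reverse_inclusion \<A>)"
  by (auto simp: reverse_inclusion_def trans_def)

lemma trans_omega_power: "trans P \<Longrightarrow> trans (omega_power P)"
  unfolding omega_power_def trans_def by blast

theorem theorem3p8:
  fixes X :: "'a set" and \<U> :: "('a \<times> 'a) set set"
  assumes "uniform_space_on X \<U>"
    and "\<not> discrete_uniformity X \<U>"
    and "precompact_below (add_card (reverse_inclusion \<U>)) X \<U>"
  shows "reverse_inclusion (identity_neighbourhoods (free_group X) (free_group_topology X \<U>))
           =\<^sub>T omega_power (reverse_inclusion \<U>)"
proof -
  interpret uniform_space_carrier X \<U>
    by unfold_locales (rule assms(1))
  let ?N = "identity_neighbourhoods F \<T>"
  have small: "small_products s \<in> ?N" if "\<forall>n. s n \<in> \<U>" for s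
    using openin_small_products[OF that] one_in_small_products small_products_subset
    by (auto simp: identity_neighbourhoods_def)
  have "reverse_inclusion ?N \<le>\<^sub>T omega_power (reverse_inclusion \<U>)"
  proof (rule tukey_le_mono[where f = small_products])
    fix s t assume "(s, t) \<in> omega_power (reverse_inclusion \<U>)"
    then have st: "\<forall>n. s n \<in> \<U>" "\<forall>n. t n \<in> \<U>" "\<And>n. t n \<subseteq> s n"
      by (auto simp: in_omega_power_reverse_inclusion)
    show "(small_products s, small_products t) \<in> reverse_inclusion ?N"
      using small[OF st(1)] small[OF st(2)] small_products_mono[OF st(3)]
      by (simp add: reverse_inclusion_def)
  next
    fix W assume "W \<in> Field (reverse_inclusion ?N)"
    then have W: "W \<in> ?N"
      by (simp add: Field_reverse_inclusion)
    obtain s where s: "\<forall>n. s n \<in> \<U>" "small_products s \<subseteq> W"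
      using small_products_cofinal[OF assms(2,3) W] by (elim exE conjE)
    show "\<exists>s\<in>Field (omega_power (reverse_inclusion \<U>)). (W, small_products s) \<in> reverse_inclusion ?N"
      unfolding Field_entourage_sequences using s small[OF s(1)] W
      by (intro bexI[of _ s]) (simp_all add: reverse_inclusion_def)
  qed (use small in \<open>simp_all add: Field_reverse_inclusion Field_entourage_sequences trans_reverse_inclusion\<close>)
  moreover have "omega_power (reverse_inclusion \<U>) \<le>\<^sub>T reverse_inclusion ?N"
  proof (rule tukey_le_mono[where f = "\<lambda>W n. power_entourage W (2 ^ n)"])
    fix V W assume "(V, W) \<in> reverse_inclusion ?N"
    then have VW: "V \<in> ?N" "W \<in> ?N" "W \<subseteq> V"
      by (auto simp: reverse_inclusion_def)
    have "power_entourage W m \<subseteq> power_entourage V m" for m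
      using VW(3) by (auto simp: power_entourage_def)
    then show "(\<lambda>n. power_entourage V (2 ^ n), \<lambda>n. power_entourage W (2 ^ n))
        \<in> omega_power (reverse_inclusion \<U>)"
      using power_entourage VW(1,2) by (simp add: in_omega_power_reverse_inclusion)
  next
    fix t assume "t \<in> Field (omega_power (reverse_inclusion \<U>))"
    then have t: "\<forall>n. t n \<in> \<U>"
      by (simp add: Field_entourage_sequences)
    obtain W where "W \<in> ?N" "\<forall>n. power_entourage W (2 ^ n) \<subseteq> t n"
      using neighbourhood_with_small_power_entourages[OF t] by (elim bexE)
    then show "\<exists>W\<in>Field (reverse_inclusion ?N).
        (t, \<lambda>n. power_entourage W (2 ^ n)) \<in> omega_power (reverse_inclusion \<U>)"
      using power_entourage t
      by (intro bexI[of _ W]) (simp_all add: in_omega_power_reverse_inclusion Field_reverse_inclusion)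
  qed (use power_entourage in \<open>simp_all add: Field_reverse_inclusion Field_entourage_sequences
      trans_reverse_inclusion trans_omega_power\<close>)
  ultimately show ?thesis
    by (simp add: tukey_eq_def)
qed

end
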